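(* Let $n\ge1$ and $1<p<\infty$. The following are equivalent for any weight $w$ on $\mathbb{C}^n$ and any $\alpha>0$: (a) $w\in \mathrm{A}_{p,r}$ for some $r>0$. (b) $H_\alpha$ is bounded on $L^p(\mathbb{C}^n,w\,dv)$. (c) $P_\alpha$ is bounded on $\mathcal{L}_\alpha^p(w)$. (d) $w\in \mathrm{A}_{p,r}$ for all $r>0$.
   Context: $dv$ is Lebesgue (volume) measure on $\mathbb{C}^n\cong\mathbb{R}^{2n}$. A weight is a measurable function on $\mathbb{C}^n$ which is positive (and finite) a.e. For $z\in\mathbb{C}^n$ and $r>0$, $Q_r(z)$ is the cube in $\mathbb{C}^n$ (sides parallel to the real coordinate axes) with center $z$ and side length $r$. $\mathrm{A}_{p,r}$ is the class of weights $w$ with $$\sup_{z\in\mathbb{C}^n}\left(\frac{1}{v(Q_r(z))}\int_{Q_r(z)}w\,dv\right)\left(\frac{1}{v(Q_r(z))}\int_{Q_r(z)}w^{-\frac{1}{p-1}}\,dv\right)^{p-1}<\infty.$$ $\mathcal{L}_\alpha^p(w)$ is the Banach space of measurable $f$ on $\mathbb{C}^n$ with $f(\cdot)e^{-\frac{\alpha}{2}|\cdot|^2}\in L^p(\mathbb{C}^n,w\,dv)$, normed by the $L^p(w\,dv)$ norm of $f e^{-\frac\alpha2|\cdot|^2}$. Write $z\cdot u=\sum_j z_j\overline{u_j}$. The Fock projection is the integral operator $$P_\alpha f(z)=\left(\frac{\alpha}{\pi}\right)^n\int_{\mathbb{C}^n}e^{\alpha z\cdot u}f(u)e^{-\alpha|u|^2}\,dv(u),$$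 and $H_\alpha$ is the integral operator $$H_\alpha f(z)=\int_{\mathbb{C}^n}e^{-\frac{\alpha}{2}|z-u|^2}f(u)\,dv(u).$$ Boundedness of such an integral operator on a space means that for every $f$ in the space the defining integral converges absolutely for a.e. $z$ and the operator norm estimate holds. *)

theory Defs
  imports "HOL-Analysis.Analysis"
begin

text \<open>
  The space \<open>\<complex>\<^sup>n\<close> is the type \<^typ>\<open>complex ^ 'n\<close> with \<open>n = CARD('n)\<close>; its library norm is the
  Euclidean one, and \<^term>\<open>lebesgue\<close> is the (completed) volume measure \<open>dv\<close>.
\<close>

definition weight :: "(complex ^ 'n \<Rightarrow> real) \<Rightarrow> bool" where
  "weight w \<longleftrightarrow> w \<in> borel_measurable lebesgue \<and> (AE z in lebesgue. 0 < w z)"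

definition cube :: "real \<Rightarrow> complex ^ 'n \<Rightarrow> (complex ^ 'n) set" where
  "cube r z = {u. \<forall>j. \<bar>Re (u $ j) - Re (z $ j)\<bar> \<le> r / 2 \<and> \<bar>Im (u $ j) - Im (z $ j)\<bar> \<le> r / 2}"

text \<open>Real powers on \<open>[0, \<infinity>]\<close>; only meant for positive exponents, where \<open>\<infinity>\<^sup>a = \<infinity>\<close>.\<close>

definition ennreal_powr :: "ennreal \<Rightarrow> real \<Rightarrow> ennreal" where
  "ennreal_powr x a = (if x = \<infinity> then \<infinity> else ennreal (enn2real x powr a))"

definition average :: "(complex ^ 'n) set \<Rightarrow> (complex ^ 'n \<Rightarrow> real) \<Rightarrow> ennreal" where
  "average Q g = (\<integral>\<^sup>+u\<in>Q. ennreal (g u) \<partial>lebesgue) / emeasure lebesgue Q"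

text \<open>
  The integrals take values in \<open>[0, \<infinity>]\<close>, so finiteness of the supremum includes the local
  integrability of \<open>w\<close> and of \<open>w\<^bsup>-1/(p-1)\<^esup>\<close>: for a weight neither factor can vanish.
\<close>

definition A_class :: "real \<Rightarrow> real \<Rightarrow> (complex ^ 'n \<Rightarrow> real) set" where
  "A_class p r = {w. weight w \<and>
     (SUP z. average (cube r z) w *
        ennreal_powr (average (cube r z) (\<lambda>u. w u powr (- 1 / (p - 1)))) (p - 1)) < \<infinity>}"

text \<open>Elements of the \<open>L\<^sup>p\<close> spaces are functions, not classes modulo null sets.\<close>

definition Lp_space :: "real \<Rightarrow> 'a measure \<Rightarrow> ('a \<Rightarrow> complex) set" where
  "Lp_space p M = {f \<in> borel_measurable M. integrable M (\<lambda>x. norm (f x) powr p)}"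

definition Lp_norm :: "real \<Rightarrow> 'a measure \<Rightarrow> ('a \<Rightarrow> complex) \<Rightarrow> real" where
  "Lp_norm p M f = (LINT x|M. norm (f x) powr p) powr (1 / p)"

definition weighted_measure :: "(complex ^ 'n \<Rightarrow> real) \<Rightarrow> (complex ^ 'n) measure" where
  "weighted_measure w = density lebesgue (\<lambda>z. ennreal (w z))"

definition gauss_mult :: "real \<Rightarrow> (complex ^ 'n \<Rightarrow> complex) \<Rightarrow> complex ^ 'n \<Rightarrow> complex" where
  "gauss_mult \<alpha> f z = f z * of_real (exp (- (\<alpha> / 2) * (norm z)\<^sup>2))"

definition Fock_Lp_space ::
    "real \<Rightarrow> real \<Rightarrow> (complex ^ 'n \<Rightarrow> real) \<Rightarrow> (complex ^ 'n \<Rightarrow> complex) set" where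
  "Fock_Lp_space \<alpha> p w =
     {f \<in> borel_measurable lebesgue. gauss_mult \<alpha> f \<in> Lp_space p (weighted_measure w)}"

definition Fock_Lp_norm ::
    "real \<Rightarrow> real \<Rightarrow> (complex ^ 'n \<Rightarrow> real) \<Rightarrow> (complex ^ 'n \<Rightarrow> complex) \<Rightarrow> real" where
  "Fock_Lp_norm \<alpha> p w f = Lp_norm p (weighted_measure w) (gauss_mult \<alpha> f)"

definition hermitian_dot :: "complex ^ 'n \<Rightarrow> complex ^ 'n \<Rightarrow> complex" where
  "hermitian_dot z u = (\<Sum>j\<in>UNIV. z $ j * cnj (u $ j))"

definition fock_kernel :: "real \<Rightarrow> complex ^ 'n \<Rightarrow> complex ^ 'n \<Rightarrow> complex" where
  "fock_kernel \<alpha> z u = of_real ((\<alpha> / pi) ^ CARD('n)) *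
     exp (of_real \<alpha> * hermitian_dot z u) * of_real (exp (- \<alpha> * (norm u)\<^sup>2))"

definition gauss_kernel :: "real \<Rightarrow> complex ^ 'n \<Rightarrow> complex ^ 'n \<Rightarrow> complex" where
  "gauss_kernel \<alpha> z u = of_real (exp (- (\<alpha> / 2) * (norm (z - u))\<^sup>2))"

definition integral_op ::
    "(complex ^ 'n \<Rightarrow> complex ^ 'n \<Rightarrow> complex) \<Rightarrow> (complex ^ 'n \<Rightarrow> complex) \<Rightarrow> complex ^ 'n \<Rightarrow> complex" where
  "integral_op K f z = (LINT u|lebesgue. K z u * f u)"

text \<open>
  Bochner integrability is absolute convergence of the defining integral. On the null set where
  it fails, \<^term>\<open>integral_op K f\<close> has the value 0, which affects neither membership nor norms.
\<close>

definition bounded_integral_op ::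
    "(complex ^ 'n \<Rightarrow> complex ^ 'n \<Rightarrow> complex) \<Rightarrow> (complex ^ 'n \<Rightarrow> complex) set \<Rightarrow>
     ((complex ^ 'n \<Rightarrow> complex) \<Rightarrow> real) \<Rightarrow> bool" where
  "bounded_integral_op K X N \<longleftrightarrow>
     (\<forall>f\<in>X. AE z in lebesgue. integrable lebesgue (\<lambda>u. K z u * f u)) \<and>
     (\<exists>C. \<forall>f\<in>X. integral_op K f \<in> X \<and> N (integral_op K f) \<le> C * N f)"

definition H_bounded :: "real \<Rightarrow> real \<Rightarrow> (complex ^ 'n \<Rightarrow> real) \<Rightarrow> bool" where
  "H_bounded \<alpha> p w \<longleftrightarrow> bounded_integral_op (gauss_kernel \<alpha>)
     (Lp_space p (weighted_measure w)) (Lp_norm p (weighted_measure w))"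

definition P_bounded :: "real \<Rightarrow> real \<Rightarrow> (complex ^ 'n \<Rightarrow> real) \<Rightarrow> bool" where
  "P_bounded \<alpha> p w \<longleftrightarrow> bounded_integral_op (fock_kernel \<alpha>)
     (Fock_Lp_space \<alpha> p w) (Fock_Lp_norm \<alpha> p w)"

end

(*
Write sigma = w^(-1/(p-1)), and W(z), V(z) for the w- and sigma-masses of the cube of side s = r/2 at z.

A_{p,r} and Hoelder's inequality make W and V comparable at nearby points, hence of at most exponential
growth in the distance, so the integral of a Gaussian centred at u against w (sigma) is O(W(u))
(O(V(u))). This bounds the masses of cubes of any other side, whence A_{p,t} for every t, and it
verifies Schur's test for H_alpha with the weight V^(p-1), since W V^(p-1) is bounded.

|e^(alpha z.u)| e^(-alpha|z|^2/2 - alpha|u|^2/2) = e^(-alpha|z-u|^2/2), so H_alpha dominates P_alpha.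

Conversely, e^(alpha z.u) = e^(alpha z.c) e^(alpha c.(u-c)) e^(alpha (z-c).(u-c)), where the real part
of the last factor is bounded below for z, u in a small cube around c. Testing P_alpha on
e^(-alpha c.(u-c)) e^(alpha|u|^2) h(u) with h a truncation of sigma gives A_{p,r} for small r.
*)

theory Submission
  imports Defs "HOL-Probability.Distributions"
begin

section \<open>Gaussian integrals and Hoelder's inequality\<close>

text \<open>The roles of w and sigma are symmetric: sigma belongs to the A class of the conjugate
  exponent p/(p-1), with W and V exchanged, so every estimate for w is also one for sigma. The half
  side s = r/2 appears because two nearby cubes of side s are compared inside a common cube of side
  2s = r, where the A bound is given. In Schur's test the ratio V(z)/V(u) grows at most
  exponentially, which the Gaussian absorbs; this is what makes V a usable auxiliary factor.
  Starting from P_alpha, neither w nor sigma is known to be locally integrable. Masses are therefore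
  kept in [0, infinity], the test functions are truncated, and finiteness comes out of the estimate.
  The obstacle in that direction is the oscillation of the kernel. Absolute values suffice to pass
  from H_alpha to P_alpha, but a lower bound must exclude cancellation: one phase is divided out by
  the test function, and the remaining one stays within one radian only if alpha n r^2 <= 1. Only
  small sides are reached in this way, so the change of scale is what closes the circle.\<close>

lemma sigma_finite_lebesgue: "sigma_finite_measure (lebesgue :: 'a::euclidean_space measure)"
proof -
  obtain A :: "'a set set" where A: "countable A" "A \<subseteq> sets lborel" "\<Union>A = space lborel"
      "\<forall>a\<in>A. emeasure lborel a \<noteq> \<infinity>"
    using lborel.sigma_finite_countable by metis
  show ?thesis
    by standard (use A in \<open>intro exI[of _ A], auto simp: emeasure_completion subset_iff\<close>)
qed

interpretation lebesgue: sigma_finite_measure "lebesgue :: 'a::euclidean_space measure"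
  by (rule sigma_finite_lebesgue)

interpretation lebesgue_pair: pair_sigma_finite
    "lebesgue :: 'a::euclidean_space measure" "lebesgue :: 'b::euclidean_space measure" ..

text \<open>Weights are only Lebesgue measurable, so Tonelli is used for the product of two
  completed measures. Kernels and cube relations enter there as Borel functions on the product
  space, and both coordinate maps remain measurable into the Borel sigma-algebra.\<close>

lemma measurable_lebesgue_pair:
  fixes f :: "'a::euclidean_space \<times> 'b::euclidean_space \<Rightarrow> 'c::topological_space"
  assumes "f \<in> borel_measurable borel"
  shows "f \<in> borel_measurable (lebesgue \<Otimes>\<^sub>M lebesgue)"
proof -
  have 1: "(\<lambda>x::'a. x) \<in> measurable lebesgue borel" "(\<lambda>x::'b. x) \<in> measurable lebesgue borel"
    by (auto simp: measurable_completion)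
  have "(\<lambda>x. (fst x, snd x)) \<in> lebesgue \<Otimes>\<^sub>M lebesgue \<rightarrow>\<^sub>M (borel \<Otimes>\<^sub>M borel :: ('a \<times> 'b) measure)"
    by (intro measurable_Pair measurable_compose[OF measurable_fst 1(1)]
        measurable_compose[OF measurable_snd 1(2)])
  then have "(\<lambda>x. x) \<in> lebesgue \<Otimes>\<^sub>M lebesgue \<rightarrow>\<^sub>M (borel :: ('a \<times> 'b) measure)"
    by (simp add: borel_prod)
  from measurable_compose[OF this assms] show ?thesis .
qed

lemma nn_integral_gaussian_real:
  fixes a :: real
  assumes "0 < a"
  shows "(\<integral>\<^sup>+ x. ennreal (exp (- a * x\<^sup>2)) \<partial>lborel) < \<infinity>"
proof -
  \<comment> \<open>The standard deviation for which the exponent of the normal density is -a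
    x^2.\<close>
  define s where "s = 1 / sqrt (2 * a)"
  have s: "s > 0" "2 * s\<^sup>2 = 1 / a"
    using assms by (auto simp: s_def power_divide field_simps)
  have eq: "exp (- a * x\<^sup>2) = normal_density 0 s x * sqrt (2 * pi * s\<^sup>2)" for x
    using s assms by (simp add: normal_density_def)
  have "integrable lborel (\<lambda>x::real. exp (- a * x\<^sup>2))"
    unfolding eq using s by (intro integrable_mult_left integrable_normal_density) auto
  then show ?thesis
    by (simp add: nn_integral_eq_integral)
qed

text \<open>Translation invariance removes the centre; along an orthonormal basis the Gaussian is a
  product of one-dimensional ones, which gives finiteness.\<close>

lemma nn_integral_gaussian:
  fixes u :: "'a::euclidean_space"
  assumes "0 < a"
  shows "(\<integral>\<^sup>+ y. ennreal (exp (- a * (norm (y - u))\<^sup>2)) \<partial>lebesgue)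
      = (\<integral>\<^sup>+ y. ennreal (exp (- a * (norm (y::'a))\<^sup>2)) \<partial>lborel)" (is ?eq)
    and "(\<integral>\<^sup>+ y. ennreal (exp (- a * (norm (y::'a))\<^sup>2)) \<partial>lborel) < \<infinity>" (is ?fin)
proof -
  have "(\<integral>\<^sup>+ y. ennreal (exp (- a * (norm (y::'a))\<^sup>2)) \<partial>lborel)
    = (\<integral>\<^sup>+ y. ennreal (exp (- a * (norm (y::'a))\<^sup>2)) \<partial>distr lborel borel ((+) (- u)))"
    by (simp only: lborel_distr_plus)
  also have "\<dots> = (\<integral>\<^sup>+ y. ennreal (exp (- a * (norm (y - u))\<^sup>2)) \<partial>lborel)"
    by (subst nn_integral_distr) auto
  finally show ?eq by (simp add: nn_integral_completion)
  have "(\<integral>\<^sup>+ y. ennreal (exp (- a * (norm (y::'a))\<^sup>2)) \<partial>lborel)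
      = (\<integral>\<^sup>+ y. (\<Prod>b\<in>Basis. ennreal (exp (- a * ((y::'a) \<bullet> b)\<^sup>2))) \<partial>lborel)"
  proof (rule nn_integral_cong)
    fix y :: 'a
    have "(norm y)\<^sup>2 = (\<Sum>b\<in>Basis. (y \<bullet> b)\<^sup>2)"
      unfolding power2_norm_eq_inner by (subst euclidean_inner) (simp add: power2_eq_square)
    then show "ennreal (exp (- a * (norm y)\<^sup>2)) = (\<Prod>b\<in>Basis. ennreal (exp (- a * (y \<bullet> b)\<^sup>2)))"
      by (simp add: prod_ennreal exp_sum[symmetric] sum_distrib_left sum_negf)
  qed
  also have "\<dots> = (\<Prod>b\<in>(Basis::'a set). (\<integral>\<^sup>+ x. ennreal (exp (- a * x\<^sup>2)) \<partial>lborel))"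
    by (rule nn_integral_lborel_prod) auto
  finally show ?fin
    using nn_integral_gaussian_real[OF assms]
    by (cases "\<integral>\<^sup>+ x. ennreal (exp (- a * x\<^sup>2)) \<partial>lborel") (auto simp: ennreal_power)
qed

section \<open>Powers in [0, infinity] and Hoelder's inequality\<close>

lemma ennreal_powr_ennreal: "0 \<le> x \<Longrightarrow> ennreal_powr (ennreal x) a = ennreal (x powr a)"
  by (simp add: ennreal_powr_def)

lemma ennreal_powr_top [simp]: "ennreal_powr top a = top"
  by (simp add: ennreal_powr_def)

lemma ennreal_powr_zero [simp]: "ennreal_powr 0 a = 0"
  by (simp add: ennreal_powr_def)

lemma ennreal_powr_mono: "0 \<le> a \<Longrightarrow> x \<le> y \<Longrightarrow> ennreal_powr x a \<le> ennreal_powr y a"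
  by (cases x; cases y) (auto simp: ennreal_powr_ennreal powr_mono2 top_unique)

lemma ennreal_powr_less_top: "ennreal_powr x a < top \<longleftrightarrow> x < top"
  by (cases x) (auto simp: ennreal_powr_ennreal)

lemma ennreal_powr_measurable [measurable]:
  assumes [measurable]: "f \<in> borel_measurable M"
  shows "(\<lambda>x. ennreal_powr (f x) a) \<in> borel_measurable M"
  unfolding ennreal_powr_def by measurable

lemma Holder_nn_integral:
  fixes f g :: "'a \<Rightarrow> real" and p :: real
  assumes p: "1 < p" and meas: "f \<in> borel_measurable M" "g \<in> borel_measurable M"
    and nonneg: "\<And>x. 0 \<le> f x" "\<And>x. 0 \<le> g x"
  shows "ennreal_powr (\<integral>\<^sup>+ x. ennreal (f x * g x) \<partial>M) p
    \<le> (\<integral>\<^sup>+ x. ennreal (f x powr p) \<partial>M)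
      * ennreal_powr (\<integral>\<^sup>+ x. ennreal (g x powr (p / (p - 1))) \<partial>M) (p - 1)"
proof -
  note [measurable] = meas
  define q where "q = p / (p - 1)"
  have q: "1 < q" "1 / p + 1 / q = 1"
    using p by (auto simp: q_def field_simps)
  define A where "A = (\<integral>\<^sup>+ x. ennreal (f x powr p) \<partial>M)"
  define B where "B = (\<integral>\<^sup>+ x. ennreal (g x powr q) \<partial>M)"
  define I where "I = (\<integral>\<^sup>+ x. ennreal (f x * g x) \<partial>M)"
  \<comment> \<open>Since 0 times infinity is 0 in \<open>ennreal\<close>, a vanishing factor comes
    first: there the integrand is zero a.e. With both factors positive, an infinite one makes the
    bound trivial.\<close>
  consider "A = 0 \<or> B = 0" | "A \<noteq> 0" "B \<noteq> 0" "A = \<infinity> \<or> B = \<infinity>"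
    | a b where "A = ennreal a" "B = ennreal b" "0 < a" "0 < b"
    by (cases A; cases B) (auto simp: order_le_less)
  then have "ennreal_powr I p \<le> A * ennreal_powr B (p - 1)"
  proof cases
    case 1
    then have "(AE x in M. f x powr p = 0) \<or> (AE x in M. g x powr q = 0)"
      by (auto simp: A_def B_def nn_integral_0_iff_AE)
    then have "I = 0"
      unfolding I_def by (subst nn_integral_0_iff_AE) (auto elim!: eventually_mono)
    then show ?thesis by simp
  next
    case 2
    then have "ennreal_powr B (p - 1) \<noteq> 0"
      by (cases B) (auto simp: ennreal_powr_ennreal)
    with 2 have "A * ennreal_powr B (p - 1) = top"
      by (auto simp: ennreal_mult_top ennreal_top_mult)
    then show ?thesis by simp
  next
    case (3 a b)
    \<comment> \<open>The product of the two norms; Young's inequality is applied to f and g divided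
      by their norms.\<close>
    define c where "c = a powr (1 / p) * b powr (1 / q)"
    have "I \<le> (\<integral>\<^sup>+ x. ennreal (c / (p * a)) * ennreal (f x powr p)
        + ennreal (c / (q * b)) * ennreal (g x powr q) \<partial>M)"
      unfolding I_def
    proof (rule nn_integral_mono)
      fix x
      have "f x / a powr (1 / p) * (g x / b powr (1 / q))
        \<le> (f x / a powr (1 / p)) powr p / p + (g x / b powr (1 / q)) powr q / q"
        by (rule Youngs_inequality) (use p q nonneg 3 in auto)
      also have "\<dots> = f x powr p / (p * a) + g x powr q / (q * b)"
        using p q 3 nonneg by (simp add: powr_divide powr_powr mult.commute)
      finally have "f x * g x \<le> c * (f x powr p / (p * a) + g x powr q / (q * b))"
        using 3 by (simp add: c_def field_simps)
      then have "ennreal (f x * g x) \<le> ennreal (c / (p * a) * f x powr p + c / (q * b) * g x powr q)"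
        by (intro ennreal_leI) (simp add: algebra_simps)
      then show "ennreal (f x * g x) \<le> ennreal (c / (p * a)) * ennreal (f x powr p)
        + ennreal (c / (q * b)) * ennreal (g x powr q)"
        using 3 p q by (subst (asm) ennreal_plus) (auto simp: ennreal_mult'[symmetric] c_def)
    qed
    also have "\<dots> = ennreal (c / (p * a)) * A + ennreal (c / (q * b)) * B"
      by (simp add: nn_integral_add nn_integral_cmult A_def B_def)
    also have "\<dots> = ennreal (c / (p * a) * a + c / (q * b) * b)"
      using 3 p q by (subst ennreal_plus) (auto simp: ennreal_mult'[symmetric] c_def)
    also have "c / (p * a) * a + c / (q * b) * b = c * (1 / p + 1 / q)"
      using 3 p q by (simp add: field_simps)
    finally have "I \<le> ennreal c" using q by simp
    then have "ennreal_powr I p \<le> ennreal_powr (ennreal c) p"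
      using p by (intro ennreal_powr_mono) auto
    also have "\<dots> = ennreal (a * b powr (p - 1))"
      using 3 p by (simp add: ennreal_powr_ennreal c_def powr_mult powr_powr q_def)
    finally show ?thesis
      using 3 by (simp add: ennreal_powr_ennreal ennreal_mult')
  qed
  then show ?thesis
    by (simp add: A_def B_def I_def q_def)
qed

section \<open>Cubes and the Muckenhoupt condition\<close>

definition dual_weight :: "real \<Rightarrow> (complex ^ 'n \<Rightarrow> real) \<Rightarrow> complex ^ 'n \<Rightarrow> real" where
  "dual_weight p w = (\<lambda>u. w u powr (- 1 / (p - 1)))"

lemma cube_commute: "u \<in> cube r z \<longleftrightarrow> z \<in> cube r u"
  unfolding cube_def mem_Collect_eq
  by (simp add: abs_minus_commute[of "Re (u $ _)"] abs_minus_commute[of "Im (u $ _)"])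

lemma closed_cube_rel: "closed {x :: (complex ^ 'n) \<times> (complex ^ 'n). snd x \<in> cube r (fst x)}"
  unfolding cube_def mem_Collect_eq
  by (intro closed_Collect_all closed_Collect_conj closed_Collect_le continuous_intros)

lemma closed_cube: "closed (cube r z)"
  unfolding cube_def
  by (intro closed_Collect_all closed_Collect_conj closed_Collect_le continuous_intros)

lemma sets_cube [measurable]: "cube r z \<in> sets lebesgue" "cube r z \<in> sets borel"
  using closed_cube[of r z] by auto

lemma norm_nth_diff_le_if_mem_cube:
  assumes "u \<in> cube r z"
  shows "norm ((u - z) $ j) \<le> r"
proof -
  have "norm ((u - z) $ j) \<le> \<bar>Re ((u - z) $ j)\<bar> + \<bar>Im ((u - z) $ j)\<bar>"
    by (rule cmod_le)
  also have "\<dots> \<le> r / 2 + r / 2"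
    using assms unfolding cube_def by (intro add_mono) auto
  finally show ?thesis by simp
qed

lemma norm_diff_le_if_mem_cube:
  fixes z :: "complex ^ 'n"
  assumes "u \<in> cube r z"
  shows "norm (u - z) \<le> real CARD('n) * r"
proof -
  have "norm (u - z) \<le> (\<Sum>j\<in>UNIV. norm ((u - z) $ j))"
    unfolding norm_vec_def by (rule L2_set_le_sum) simp
  also have "\<dots> \<le> (\<Sum>j\<in>(UNIV::'n set). r)"
    by (intro sum_mono norm_nth_diff_le_if_mem_cube assms)
  finally show ?thesis by simp
qed

lemma mem_cube_if_norm_diff_le:
  fixes z :: "complex ^ 'n"
  assumes "norm (u - z) \<le> r / 2"
  shows "u \<in> cube r z"
proof -
  have "\<bar>Re (u $ j) - Re (z $ j)\<bar> \<le> r / 2" "\<bar>Im (u $ j) - Im (z $ j)\<bar> \<le> r / 2" for j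
    using assms Finite_Cartesian_Product.norm_nth_le[of "u - z" j] abs_Re_le_cmod[of "(u - z) $ j"]
      abs_Im_le_cmod[of "(u - z) $ j"] by auto
  then show ?thesis by (simp add: cube_def)
qed

lemma cube_subset_cube:
  fixes z :: "complex ^ 'n"
  assumes "norm (u - z) \<le> d" "s + 2 * d \<le> r"
  shows "cube s u \<subseteq> cube r z"
proof
  fix v assume v: "v \<in> cube s u"
  have d: "\<bar>Re (u $ j) - Re (z $ j)\<bar> \<le> d" "\<bar>Im (u $ j) - Im (z $ j)\<bar> \<le> d" for j
    using assms Finite_Cartesian_Product.norm_nth_le[of "u - z" j] abs_Re_le_cmod[of "(u - z) $ j"]
      abs_Im_le_cmod[of "(u - z) $ j"] by auto
  have "\<bar>Re (v $ j) - Re (z $ j)\<bar> \<le> r / 2 \<and> \<bar>Im (v $ j) - Im (z $ j)\<bar> \<le> r / 2" for j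
  proof -
    have "\<bar>Re (v $ j) - Re (u $ j)\<bar> \<le> s / 2" "\<bar>Im (v $ j) - Im (u $ j)\<bar> \<le> s / 2"
      using v by (auto simp: cube_def)
    then show ?thesis using d[of j] assms(2) by linarith
  qed
  then show "v \<in> cube r z" by (simp add: cube_def)
qed

lemma cube_mono: "s \<le> r \<Longrightarrow> cube s z \<subseteq> cube r z"
  using cube_subset_cube[of z z 0 s r] by simp

lemma bounded_cube: "bounded (cube r (z :: complex ^ 'n))"
  unfolding bounded_def dist_norm
  using norm_diff_le_if_mem_cube[of _ r z] by (metis norm_minus_commute)

lemma lmeasurable_cube: "cube r z \<in> lmeasurable"
  by (simp add: bounded_cube closed_cube compact_eq_bounded_closed lmeasurable_compact)

text \<open>The type argument carries the dimension, which the side length alone does not determine;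
  the centre is irrelevant by translation invariance.\<close>

definition cube_volume :: "'n::finite itself \<Rightarrow> real \<Rightarrow> real" where
  "cube_volume _ r = measure lebesgue (cube r (0 :: complex ^ 'n))"

lemma emeasure_cube:
  fixes z :: "complex ^ 'n"
  shows "emeasure lebesgue (cube r z) = ennreal (cube_volume TYPE('n::finite) r)"
proof -
  have "cube r z = (+) z ` cube r 0"
  proof (intro equalityI subsetI)
    fix u assume "u \<in> cube r z"
    then show "u \<in> (+) z ` cube r 0"
      by (intro image_eqI[of _ _ "u - z"]) (auto simp: cube_def)
  qed (auto simp: cube_def)
  then have "measure lebesgue (cube r z) = cube_volume TYPE('n::finite) r"
    by (simp add: cube_volume_def measure_translation)
  then show ?thesis
    using lmeasurable_cube[of r z] by
      (simp add: emeasure_eq_measure2 fmeasurableD2 emeasure_eq_ennreal_measure)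
qed

lemma cube_volume_pos:
  assumes "0 < r"
  shows "0 < cube_volume TYPE('n::finite) r"
proof -
  have "ball (0 :: complex ^ 'n) (r / 2) \<subseteq> cube r 0"
    by (intro subsetI mem_cube_if_norm_diff_le) (simp add: dist_norm)
  then have "measure lebesgue (ball (0 :: complex ^ 'n) (r / 2)) \<le> cube_volume TYPE('n::finite) r"
    unfolding cube_volume_def using lmeasurable_cube by (intro measure_mono_fmeasurable) auto
  moreover have "0 < measure lebesgue (ball (0 :: complex ^ 'n) (r / 2))"
    using assms content_ball_pos[of "r / 2" "0 :: complex ^ 'n"] by (simp)
  ultimately show ?thesis by linarith
qed

section \<open>Weighted measures, and the Muckenhoupt condition in terms of cube masses\<close>

lemma weight_measurable: "weight w \<Longrightarrow> w \<in> borel_measurable lebesgue"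
  and weight_pos: "weight w \<Longrightarrow> AE z in lebesgue. 0 < w z"
  by (auto simp: weight_def)

lemma sets_weighted_measure [simp, measurable_cong]: "sets (weighted_measure w) = sets lebesgue"
  by (simp add: weighted_measure_def)

lemma weight_dual_weight: "weight w \<Longrightarrow> weight (dual_weight p w)"
  unfolding weight_def dual_weight_def by (auto elim!: eventually_mono)

text \<open>The exponents 1/(p-1) and 1/(p/(p-1) - 1) are reciprocal, so dualising twice restores
  the weight wherever it is positive.\<close>

lemma dual_weight_dual_weight:
  assumes "1 < p" "weight w"
  shows "AE z in lebesgue. dual_weight (p / (p - 1)) (dual_weight p w) z = w z"
  using weight_pos[OF assms(2)]
proof eventually_elim
  case (elim z)
  have "- 1 / (p - 1) * (- 1 / (p / (p - 1) - 1)) = 1"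
    using assms(1) by (simp add: field_simps)
  then show ?case
    unfolding dual_weight_def powr_powr using elim by simp
qed

lemma weighted_measure_cong:
  assumes "AE z in lebesgue. v z = w z" "v \<in> borel_measurable lebesgue" "w \<in> borel_measurable lebesgue"
  shows "weighted_measure v = weighted_measure w"
  unfolding weighted_measure_def
  by (rule density_cong) (use assms in \<open>auto elim!: eventually_mono\<close>)

lemma nn_integral_weighted_measure:
  assumes "weight w" "f \<in> borel_measurable lebesgue"
  shows "(\<integral>\<^sup>+ z. f z \<partial>weighted_measure w) = (\<integral>\<^sup>+ z. ennreal (w z) * f z \<partial>lebesgue)"
  unfolding weighted_measure_def
  by (rule nn_integral_density) (use assms in \<open>auto simp: weight_def\<close>)

lemma emeasure_weighted_measure:
  assumes "weight w" "S \<in> sets lebesgue"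
  shows "emeasure (weighted_measure w) S = (\<integral>\<^sup>+ z. ennreal (w z) * indicator S z \<partial>lebesgue)"
  unfolding weighted_measure_def
  by (rule emeasure_density) (use assms in \<open>auto simp: weight_def\<close>)

text \<open>A weight is positive a.e., so w dv and dv have the same null sets.\<close>

lemma AE_weighted_measure:
  assumes "weight w"
  shows "(AE z in weighted_measure w. P z) \<longleftrightarrow> (AE z in lebesgue. P z)"
  unfolding weighted_measure_def using assms weight_pos[OF assms]
  by (subst AE_density) (auto simp: weight_def elim!: eventually_elim2)

lemma emeasure_weighted_measure_pos:
  assumes "weight w" "S \<in> sets lebesgue" "emeasure lebesgue S \<noteq> 0"
  shows "0 < emeasure (weighted_measure w) S"
proof (rule ccontr)
  assume "\<not> ?thesis"
  then have "S \<in> null_sets (weighted_measure w)"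
    using assms by (simp add: null_sets_def)
  then have "AE z in lebesgue. z \<notin> S"
    using AE_weighted_measure[OF assms(1)] AE_not_in by blast
  then have "S \<in> null_sets lebesgue"
    using assms by (simp add: AE_iff_null_sets)
  with assms show False by auto
qed

lemma emeasure_weighted_cube_pos:
  assumes "weight w" "0 < r"
  shows "0 < emeasure (weighted_measure w) (cube r (z :: complex ^ 'n))"
  using assms cube_volume_pos[OF assms(2), where 'n='n]
  by (intro emeasure_weighted_measure_pos) (auto simp: emeasure_cube)

text \<open>The volume enters with exponent 1 + (p - 1) = p and factors out as a positive finite
  constant. The A condition thus becomes a uniform bound on the product of masses W V^(p-1).\<close>

lemma average_product:
  assumes "weight w" "0 < r" "1 < p"
  shows "average (cube r (z :: complex ^ 'n)) w *
        ennreal_powr (average (cube r z) (\<lambda>u. w u powr (- 1 / (p - 1)))) (p - 1)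
    = ennreal (cube_volume TYPE('n::finite) r powr (- p)) * (emeasure (weighted_measure w) (cube r z)
      * ennreal_powr (emeasure (weighted_measure (dual_weight p w)) (cube r z)) (p - 1))"
proof -
  define m where "m = cube_volume TYPE('n::finite) r"
  have m: "0 < m" using assms by (simp add: m_def cube_volume_pos)
  have av: "average (cube r z) v = emeasure (weighted_measure v) (cube r z) / ennreal m"
    if "weight v" for v
    unfolding average_def emeasure_cube m_def using that by (simp add: emeasure_weighted_measure)
  \<comment> \<open>When x or y is infinite, both sides are 0 or both are \<open>top\<close>; the
    value 0 occurs exactly when the other factor vanishes.\<close>
  have "x / ennreal m * ennreal_powr (y / ennreal m) (p - 1)
      = ennreal (m powr (- p)) * (x * ennreal_powr y (p - 1))" for x y
  proof (cases x; cases y)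
    fix a b assume *: "x = ennreal a" "0 \<le> a" "y = ennreal b" "0 \<le> b"
    have "a / m * (b / m) powr (p - 1) = m powr (- p) * (a * b powr (p - 1))"
      using m * by (simp add: powr_divide powr_minus powr_diff field_simps)
    then show ?thesis
      using m * by (simp add: divide_ennreal ennreal_powr_ennreal ennreal_mult'[symmetric])
  next
    fix b assume *: "x = top" "y = ennreal b" "0 \<le> b"
    show ?thesis
      by (cases "b = 0") (use * m in \<open>auto simp: divide_ennreal ennreal_powr_ennreal ennreal_top_divide
        ennreal_mult_top ennreal_top_mult\<close>)
  next
    fix a assume *: "x = ennreal a" "0 \<le> a" "y = top"
    show ?thesis
      by (cases "a = 0") (use * m in \<open>auto simp: divide_ennreal ennreal_powr_ennreal ennreal_top_divide
        ennreal_mult_top ennreal_top_mult\<close>)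
  next
    assume "x = top" "y = top"
    then show ?thesis using m by (auto simp: ennreal_top_divide ennreal_mult_top ennreal_top_mult)
  qed
  then show ?thesis
    using av[of w] av[of "dual_weight p w"] assms(1) weight_dual_weight[OF assms(1), of p]
    by (simp add: dual_weight_def m_def)
qed

text \<open>Cube masses of a weight are positive, so finiteness of the product forces both factors
  to be finite. From here on the bound can be handled with real numbers.\<close>

lemma A_class_imp_bounds:
  fixes w :: "complex ^ 'n \<Rightarrow> real"
  assumes "w \<in> A_class p r" "1 < p" "0 < r"
  obtains C where "0 < C"
    "\<And>z. emeasure (weighted_measure w) (cube r z) < \<infinity>"
    "\<And>z. emeasure (weighted_measure (dual_weight p w)) (cube r z) < \<infinity>"
    "\<And>z. measure (weighted_measure w) (cube r z)
      * measure (weighted_measure (dual_weight p w)) (cube r z) powr (p - 1) \<le> C"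
proof -
  have w: "weight w" and sup: "(SUP z. average (cube r z) w *
        ennreal_powr (average (cube r z) (\<lambda>u. w u powr (- 1 / (p - 1)))) (p - 1)) < \<infinity>"
    using assms(1) by (auto simp: A_class_def)
  define m where "m = cube_volume TYPE('n::finite) r"
  have m: "0 < m" using assms by (simp add: m_def cube_volume_pos)
  define W where "W z = emeasure (weighted_measure w) (cube r z)" for z
  define V where "V z = emeasure (weighted_measure (dual_weight p w)) (cube r z)" for z
  obtain K where K: "0 \<le> K" "(SUP z. ennreal (m powr (- p)) * (W z * ennreal_powr (V z) (p - 1)))
    = ennreal K"
    using sup unfolding average_product[OF w assms(3,2)] W_def V_def m_def by
      (auto simp: less_top_ennreal)
  have 1: "ennreal (m powr (- p)) * (W z * ennreal_powr (V z) (p - 1)) \<le> ennreal K" for z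
    unfolding K(2)[symmetric] by (rule SUP_upper) simp
  have pos: "0 < W z" "0 < V z" for z
    using emeasure_weighted_cube_pos[OF w assms(3)]
      emeasure_weighted_cube_pos[OF weight_dual_weight[OF w] assms(3)] by (auto simp: W_def V_def)
  have fin: "W z \<noteq> top" "V z \<noteq> top" for z
  proof -
    have "W z * ennreal_powr (V z) (p - 1) \<noteq> top"
      using 1[of z] m by (auto simp: ennreal_mult_top top_unique)
    moreover have "ennreal_powr (V z) (p - 1) \<noteq> 0"
      using pos(2)[of z] by (cases "V z") (auto simp: ennreal_powr_ennreal)
    ultimately show "W z \<noteq> top" "V z \<noteq> top"
      using pos(1)[of z] by (auto simp: ennreal_mult_top ennreal_top_mult split: if_splits)
  qed
  show ?thesis
  \<comment> \<open>\<open>K\<close> is only known to be nonnegative; the added 1 makes the constant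
    positive.\<close>
  proof (rule that[of "m powr p * K + 1"])
    fix z
    show "emeasure (weighted_measure w) (cube r z) < \<infinity>"
      "emeasure (weighted_measure (dual_weight p w)) (cube r z) < \<infinity>"
      using fin by (auto simp: W_def V_def less_top)
    have "ennreal (m powr (- p) * (measure (weighted_measure w) (cube r z)
      * measure (weighted_measure (dual_weight p w)) (cube r z) powr (p - 1))) \<le> ennreal K"
      using 1[of z] fin unfolding W_def V_def
      by (simp add: emeasure_eq_ennreal_measure ennreal_powr_ennreal ennreal_mult)
    then have "m powr (- p) * (measure (weighted_measure w) (cube r z)
      * measure (weighted_measure (dual_weight p w)) (cube r z) powr (p - 1)) \<le> K"
      using K by (simp add: ennreal_le_iff)
    then show "measure (weighted_measure w) (cube r z)
      * measure (weighted_measure (dual_weight p w)) (cube r z) powr (p - 1) \<le> m powr p * K + 1"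
      using m by (simp add: powr_minus field_simps)
  qed (use K m in \<open>auto intro: add_nonneg_pos\<close>)
qed

text \<open>The assumed bound lives in [0, infinity], so it can be established before either mass is
  known to be finite.\<close>

lemma A_classI:
  fixes w :: "complex ^ 'n \<Rightarrow> real"
  assumes w: "weight w" and "1 < p" "0 < r"
    and bd: "\<And>z. emeasure (weighted_measure w) (cube r z)
      * ennreal_powr (emeasure (weighted_measure (dual_weight p w)) (cube r z)) (p - 1) \<le> ennreal C"
  shows "w \<in> A_class p r"
proof -
  have "(SUP z. average (cube r z) w *
        ennreal_powr (average (cube r z) (\<lambda>u. w u powr (- 1 / (p - 1)))) (p - 1))
      \<le> ennreal (cube_volume TYPE('n::finite) r powr (- p)) * ennreal C"
    unfolding average_product[OF w assms(3,2)] by (intro SUP_least mult_left_mono bd) auto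
  also have "\<dots> < \<infinity>" by (simp add: ennreal_mult_less_top)
  finally show ?thesis using w by (simp add: A_class_def)
qed

text \<open>Raise W V^(p-1) <= C to the power 1/(p-1), which is the conjugate exponent minus 1, and
  use that the dual of sigma is w again. This transfers the growth and Gaussian estimates from w to
  sigma.\<close>

lemma A_class_dual_weight:
  assumes "w \<in> A_class p r" "1 < p" "0 < r"
  shows "dual_weight p w \<in> A_class (p / (p - 1)) r"
proof -
  obtain C where C: "0 < C"
    "\<And>z. emeasure (weighted_measure w) (cube r z) < \<infinity>"
    "\<And>z. emeasure (weighted_measure (dual_weight p w)) (cube r z) < \<infinity>"
    "\<And>z. measure (weighted_measure w) (cube r z)
      * measure (weighted_measure (dual_weight p w)) (cube r z) powr (p - 1) \<le> C"
    using A_class_imp_bounds[OF assms] by metis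
  have w: "weight w" using assms(1) by (simp add: A_class_def)
  have eq: "weighted_measure (dual_weight (p / (p - 1)) (dual_weight p w)) = weighted_measure w"
    by (intro weighted_measure_cong dual_weight_dual_weight assms w weight_measurable weight_dual_weight)
  have q: "p / (p - 1) - 1 = 1 / (p - 1)" "1 < p / (p - 1)"
    using assms(2) by (auto simp: field_simps)
  show ?thesis
  proof (rule A_classI[where C = "C powr (1 / (p - 1))"])
    fix z
    define W where "W = measure (weighted_measure w) (cube r z)"
    define V where "V = measure (weighted_measure (dual_weight p w)) (cube r z)"
    have nn: "0 \<le> W" "0 \<le> V" by (auto simp: W_def V_def)
    have "V * W powr (1 / (p - 1)) = (W * V powr (p - 1)) powr (1 / (p - 1))"
      using assms(2) nn by (simp add: powr_mult powr_powr)
    also have "\<dots> \<le> C powr (1 / (p - 1))"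
      using C(4)[of z] assms(2) nn by (intro powr_mono2) (auto simp: W_def V_def)
    finally show "emeasure (weighted_measure (dual_weight p w)) (cube r z) *
         ennreal_powr (emeasure (weighted_measure (dual_weight (p / (p - 1)) (dual_weight p w)))
           (cube r z))
          (p / (p - 1) - 1) \<le> ennreal (C powr (1 / (p - 1)))"
      unfolding eq q using C(2,3)[of z]
      by (simp add: emeasure_eq_ennreal_measure ennreal_powr_ennreal ennreal_mult[symmetric] W_def V_def)
  qed (use w q assms in \<open>auto simp: weight_dual_weight\<close>)
qed

section \<open>Growth of cube masses\<close>

lemma ennreal_mult_mult:
  "0 \<le> x \<Longrightarrow> 0 \<le> y \<Longrightarrow> ennreal x * (ennreal y * z) = ennreal (x * y) * z"
  by (simp add: ennreal_mult mult.assoc)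

text \<open>Hoelder's inequality for 1 = w^(1/p) w^(-1/p) on \<open>S\<close>. It bounds the product
  of masses from below for every weight, opposite to the A condition.\<close>

lemma measure_powr_le_weighted_measures:
  assumes w: "weight w" and p: "1 < p" and S: "S \<in> sets lebesgue"
  shows "ennreal_powr (emeasure lebesgue S) p
    \<le> emeasure (weighted_measure w) S
      * ennreal_powr (emeasure (weighted_measure (dual_weight p w)) S) (p - 1)"
proof -
  note [measurable] = S weight_measurable[OF w] weight_measurable[OF weight_dual_weight[OF w]]
  define f where "f x = w x powr (1 / p) * indicator S x" for x
  define g where "g x = w x powr (- 1 / p) * indicator S x" for x
  have "emeasure lebesgue S = (\<integral>\<^sup>+ x. indicator S x \<partial>lebesgue)"
    by simp
  also have "\<dots> = (\<integral>\<^sup>+ x. ennreal (f x * g x) \<partial>lebesgue)"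
    by (intro nn_integral_cong_AE eventually_mono[OF weight_pos[OF w]])
      (auto simp: f_def g_def powr_add[symmetric] split: split_indicator)
  finally have "ennreal_powr (emeasure lebesgue S) p
    \<le> (\<integral>\<^sup>+ x. ennreal (f x powr p) \<partial>lebesgue)
      * ennreal_powr (\<integral>\<^sup>+ x. ennreal (g x powr (p / (p - 1))) \<partial>lebesgue) (p - 1)"
    by (simp only:) (rule Holder_nn_integral, use p in \<open>auto simp: f_def g_def\<close>)
  also have "(\<integral>\<^sup>+ x. ennreal (f x powr p) \<partial>lebesgue) = emeasure (weighted_measure w) S"
    unfolding emeasure_weighted_measure[OF w S]
    by (intro nn_integral_cong_AE eventually_mono[OF weight_pos[OF w]])
      (use p in \<open>auto simp: f_def powr_powr split: split_indicator\<close>)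
  also have "(\<integral>\<^sup>+ x. ennreal (g x powr (p / (p - 1))) \<partial>lebesgue)
      = emeasure (weighted_measure (dual_weight p w)) S"
    unfolding emeasure_weighted_measure[OF weight_dual_weight[OF w] S]
    by (intro nn_integral_cong_AE eventually_mono[OF weight_pos[OF w]])
      (use p in \<open>auto simp: g_def powr_powr dual_weight_def split: split_indicator\<close>)
  finally show ?thesis .
qed

text \<open>Both cubes lie in the cube of side 2s at z. The p-th power of the volume is at most W(u)
  times the (p-1)-th power of the sigma-mass of that large cube; multiplying by W(z) and using the A
  bound on the large cube leaves a constant times W(u).\<close>

lemma A_class_doubling:
  fixes w :: "complex ^ 'n \<Rightarrow> real"
  assumes A: "w \<in> A_class p (2 * s)" and p: "1 < p" and s: "0 < s"
  obtains D where "1 \<le> D" "\<And>z u. norm (z - u) \<le> s / 2 \<Longrightarrow>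
    measure (weighted_measure w) (cube s z) \<le> D * measure (weighted_measure w) (cube s u)"
proof -
  define \<mu> where "\<mu> = weighted_measure w"
  define \<nu> where "\<nu> = weighted_measure (dual_weight p w)"
  have w: "weight w" using A by (simp add: A_class_def)
  obtain C where C: "0 < C"
    "\<And>z. emeasure \<mu> (cube (2 * s) z) < \<infinity>" "\<And>z. emeasure \<nu> (cube (2 * s) z) < \<infinity>"
    "\<And>z. measure \<mu> (cube (2 * s) z) * measure \<nu> (cube (2 * s) z) powr (p - 1) \<le> C"
    using A_class_imp_bounds[OF A p] s unfolding \<mu>_def \<nu>_def by (metis mult_pos_pos zero_less_numeral)
  define m where "m = cube_volume TYPE('n::finite) s"
  have m: "0 < m" using s by (simp add: m_def cube_volume_pos)
  have [simp]: "sets \<mu> = sets lebesgue" "sets \<nu> = sets lebesgue" by (auto simp: \<mu>_def \<nu>_def)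
  \<comment> \<open>The maximum with 1 makes the growth rate ln D nonnegative later.\<close>
  have "measure \<mu> (cube s z) \<le> max 1 (C / m powr p) * measure \<mu> (cube s u)"
    if "norm (z - u) \<le> s / 2" for z u
  proof -
    have sub: "cube s u \<subseteq> cube (2 * s) z" "cube s z \<subseteq> cube (2 * s) z"
      using cube_subset_cube[of u z "s / 2" s "2 * s"] cube_mono[of s "2 * s" z] that s
      by (auto simp: norm_minus_commute)
    have fin: "emeasure \<mu> (cube s u) < \<infinity>" "emeasure \<nu> (cube s u) < \<infinity>"
      by (rule le_less_trans[OF emeasure_mono[OF sub(1)]], simp, rule C)+
    have mono: "measure \<nu> (cube s u) \<le> measure \<nu> (cube (2 * s) z)"
        "measure \<mu> (cube s z) \<le> measure \<mu> (cube (2 * s) z)"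
      unfolding measure_def using C(2,3)[of z] sub by (auto intro!: enn2real_mono emeasure_mono)
    have "ennreal (m powr p) \<le> ennreal (measure \<mu> (cube s u) * measure \<nu> (cube s u) powr (p - 1))"
      using measure_powr_le_weighted_measures[OF w p, of "cube s u"] fin m
      by (simp add: \<mu>_def \<nu>_def emeasure_cube m_def emeasure_eq_ennreal_measure ennreal_powr_ennreal ennreal_mult)
    then have "m powr p \<le> measure \<mu> (cube s u) * measure \<nu> (cube s u) powr (p - 1)"
      by (simp add: ennreal_le_iff)
    also have "\<dots> \<le> measure \<mu> (cube s u) * measure \<nu> (cube (2 * s) z) powr (p - 1)"
      using mono p by (intro mult_left_mono powr_mono2) auto
    finally have "measure \<mu> (cube s z) * m powr p
      \<le> measure \<mu> (cube (2 * s) z) * (measure \<mu> (cube s u) * measure \<nu> (cube (2 * s) z) powr (p - 1))"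
      using mono by (intro mult_mono) auto
    also have "\<dots> = measure \<mu> (cube s u) *
        (measure \<mu> (cube (2 * s) z) * measure \<nu> (cube (2 * s) z) powr (p - 1))"
      by (simp add: mult_ac)
    also have "\<dots> \<le> measure \<mu> (cube s u) * C"
      using C(4) by (intro mult_left_mono) auto
    finally have "measure \<mu> (cube s z) \<le> C / m powr p * measure \<mu> (cube s u)"
      using m by (simp add: field_simps)
    also have "\<dots> \<le> max 1 (C / m powr p) * measure \<mu> (cube s u)"
      by (intro mult_right_mono) auto
    finally show ?thesis .
  qed
  then show ?thesis
    by (intro that[of "max 1 (C / m powr p)"]) (auto simp: \<mu>_def)
qed

text \<open>Join z to u by m steps of length at most h, each costing a factor D. About |z - u| / h
  steps suffice; rounding up accounts for the extra D in front.\<close>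

lemma exp_growth_of_local_comparison:
  fixes F :: "'a::real_normed_vector \<Rightarrow> real"
  assumes h: "0 < h" and D: "1 \<le> D" and nonneg: "\<And>u. 0 \<le> F u"
    and loc: "\<And>z u. norm (z - u) \<le> h \<Longrightarrow> F z \<le> D * F u"
  shows "F z \<le> D * exp (ln D / h * norm (z - u)) * F u"
proof -
  have step: "norm (z - u) \<le> real m * h \<Longrightarrow> F z \<le> D ^ m * F u" for m z u
  proof (induction m arbitrary: z)
    case (Suc m)
    \<comment> \<open>The first division point when the segment from z to u is cut into
      \<open>Suc m\<close> equal pieces, so that m pieces remain between v and u.\<close>
    define v where "v = z + (1 / real (Suc m)) *\<^sub>R (u - z)"
    have "z - v = (- 1 / real (Suc m)) *\<^sub>R (u - z)" by (simp add: v_def)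
    then have "norm (z - v) = norm (z - u) / real (Suc m)"
      by (simp only: norm_scaleR norm_minus_commute[of u z]) simp
    also have "\<dots> \<le> h" using Suc.prems by (simp add: field_simps)
    finally have 1: "F z \<le> D * F v" by (rule loc)
    have "v - u = (1 - 1 / real (Suc m)) *\<^sub>R (z - u)"
      by (simp add: v_def algebra_simps)
    then have "norm (v - u) = (1 - 1 / real (Suc m)) * norm (z - u)" by simp
    also have "\<dots> \<le> (1 - 1 / real (Suc m)) * (real (Suc m) * h)"
      using Suc.prems by (intro mult_left_mono) auto
    also have "\<dots> = real m * h" by (simp add: field_simps)
    finally have "F v \<le> D ^ m * F u" by (rule Suc.IH)
    then have "D * F v \<le> D * (D ^ m * F u)" using D by (intro mult_left_mono) auto
    with 1 show ?case by (simp add: mult_ac)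
  qed simp
  define m where "m = nat \<lceil>norm (z - u) / h\<rceil>"
  have m: "norm (z - u) / h \<le> real m" "real m \<le> norm (z - u) / h + 1"
    using h unfolding m_def by (auto simp: of_nat_nat intro: ceiling_correct)
  have "F z \<le> D ^ m * F u" using m(1) h by (intro step) (simp add: field_simps)
  also have "D ^ m = exp (ln D * real m)"
    using D by (simp add: exp_of_nat2_mult mult.commute exp_of_nat_mult)
  also have "\<dots> \<le> exp (ln D * (norm (z - u) / h + 1))"
    using m(2) D by (auto intro: mult_left_mono)
  also have "\<dots> = D * exp (ln D / h * norm (z - u))"
    using D by (simp add: exp_add algebra_simps)
  finally show ?thesis using nonneg[of u] by (simp add: mult_right_mono)
qed

text \<open>Completing the square: half of the Gaussian decay is spent on absorbing the linear
  exponent, and the other half remains integrable.\<close>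

lemma exp_linear_minus_quadratic_le:
  fixes a B t :: real
  assumes "0 < a"
  shows "exp (B * t) * exp (- (a / 2) * t\<^sup>2) \<le> exp (B\<^sup>2 / a) * exp (- (a / 4) * t\<^sup>2)"
proof -
  have "0 \<le> a * (B / a - t / 2)\<^sup>2" using assms by simp
  also have "\<dots> = B\<^sup>2 / a - B * t + a / 4 * t\<^sup>2"
    using assms by (simp add: power2_eq_square field_simps)
  finally have "B * t + - (a / 2) * t\<^sup>2 \<le> B\<^sup>2 / a + - (a / 4) * t\<^sup>2" by (simp add: field_simps)
  then show ?thesis unfolding exp_add[symmetric] by simp
qed

lemma measurable_indicator_cube_rel:
  "(indicator {x :: (complex ^ 'n) \<times> (complex ^ 'n). snd x \<in> cube s (fst x)} :: _ \<Rightarrow> ennreal)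
    \<in> borel_measurable (lebesgue \<Otimes>\<^sub>M lebesgue)"
  by (intro measurable_lebesgue_pair borel_measurable_indicator borel_closed closed_cube_rel)

text \<open>Averaging over the cubes containing a point turns the Gaussian integral against the weight into a
  Gaussian integral of the cube masses, whose exponential growth the Gaussian absorbs.\<close>

lemma gaussian_integral_le_cube_mass:
  fixes w :: "complex ^ 'n \<Rightarrow> real"
  assumes w: "weight w" and s: "0 < s" and a: "0 < a" and AB: "0 \<le> A" "0 \<le> B"
    and growth: "\<And>y u. emeasure (weighted_measure w) (cube s y)
      \<le> ennreal (A * exp (B * norm (y - u))) * emeasure (weighted_measure w) (cube s u)"
  obtains C where "0 < C" "\<And>u. (\<integral>\<^sup>+ z. ennreal (exp (- a * (norm (z - u))\<^sup>2)) \<partial>weighted_measure w)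
    \<le> ennreal C * emeasure (weighted_measure w) (cube s u)"
proof -
  note [measurable] = weight_measurable[OF w]
  define W where "W y = emeasure (weighted_measure w) (cube s y)" for y
  define m where "m = cube_volume TYPE('n::finite) s"
  have m: "0 < m" using s by (simp add: m_def cube_volume_pos)
  define d where "d = real CARD('n) * s"
  \<comment> \<open>The three losses: moving the Gaussian from z to a point y of its cube, the
    factor \<open>A\<close> of the growth bound, and the absorption of the exponential
    growth.\<close>
  define c where "c = exp (a * d\<^sup>2) * A * exp (B\<^sup>2 / a)"
  have c: "0 \<le> c" using AB by (simp add: c_def)
  obtain G where G: "0 \<le> G" "(\<integral>\<^sup>+ y. ennreal (exp (- (a / 4)
    * (norm (y :: complex ^ 'n))\<^sup>2)) \<partial>lborel) = ennreal G"
    using nn_integral_gaussian(2)[of "a / 4", where 'a="complex ^ 'n"] a by (auto simp: less_top_ennreal)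
  define J :: "(complex ^ 'n) \<times> (complex ^ 'n) \<Rightarrow> ennreal"
    where "J = indicator {x. snd x \<in> cube s (fst x)}"
  have [measurable]: "J \<in> borel_measurable (lebesgue \<Otimes>\<^sub>M lebesgue)"
    unfolding J_def by (rule measurable_indicator_cube_rel)
  have J: "J (z, y) = indicator (cube s z) y" "J (z, y) = indicator (cube s y) z" for z y
    using cube_commute[of y s z] by (auto simp: J_def split: split_indicator)
  have main: "ennreal m * (\<integral>\<^sup>+ z. ennreal (exp (- a * (norm (z - u))\<^sup>2)) \<partial>weighted_measure w)
      \<le> ennreal (c * G) * W u" for u :: "complex ^ 'n"
  proof -
    define k where "k z = ennreal (exp (- a * (norm (z - u))\<^sup>2))" for z :: "complex ^ 'n"
    have k[measurable]: "k \<in> borel_measurable lebesgue"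
      unfolding k_def by (intro measurable_completion) measurable
    \<comment> \<open>The constant \<open>m\<close> is the volume of the cube at z, hence an
      integral over y. After Tonelli, the relation is read the other way, z in the cube at y, and
      the inner integral produces the mass W(y).\<close>
    have "ennreal m * (\<integral>\<^sup>+ z. k z \<partial>weighted_measure w)
        = (\<integral>\<^sup>+ z. ennreal (w z) * k z * emeasure lebesgue (cube s z) \<partial>lebesgue)"
      unfolding nn_integral_weighted_measure[OF w k] emeasure_cube m_def
      by (subst nn_integral_cmult[symmetric]) (auto simp: mult_ac)
    also have "\<dots> = (\<integral>\<^sup>+ z. (\<integral>\<^sup>+ y. ennreal (w z) * k z
        * J (z, y) \<partial>lebesgue) \<partial>lebesgue)"
    proof (rule nn_integral_cong)
      fix z
      show "ennreal (w z) * k z * emeasure lebesgue (cube s z) = (\<integral>\<^sup>+ y. ennreal (w z) * k z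
        * J (z, y) \<partial>lebesgue)"
        by (simp add: nn_integral_cmult J(1))
    qed
    also have "\<dots> = (\<integral>\<^sup>+ y. (\<integral>\<^sup>+ z. ennreal (w z) * k z
        * J (z, y) \<partial>lebesgue) \<partial>lebesgue)"
      by (intro lebesgue_pair.Fubini'[symmetric]) (simp add: split_beta')
    also have "\<dots> \<le> (\<integral>\<^sup>+ y. ennreal (c * exp (- (a / 4) * (norm (y - u))\<^sup>2)) * W u \<partial>lebesgue)"
    proof (rule nn_integral_mono)
      fix y
      have "(\<integral>\<^sup>+ z. ennreal (w z) * k z
        * J (z, y) \<partial>lebesgue)
       \<le> (\<integral>\<^sup>+ z. ennreal (exp (a * d\<^sup>2) * exp (- (a / 2) * (norm (y - u))\<^sup>2))
         * (ennreal (w z) * indicator (cube s y) z) \<partial>lebesgue)"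
      proof (rule nn_integral_mono)
        fix z
        have "k z \<le> ennreal (exp (a * d\<^sup>2) * exp (- (a / 2) * (norm (y - u))\<^sup>2))" if "z \<in> cube s y"
        proof -
          \<comment> \<open>Replacing z by y halves the exponent, since (x + d)^2 <= 2 x^2 + 2 d^2;
            absorbing the growth of W halves it again, to a/4.\<close>
          have "norm (y - u) \<le> norm (z - u) + d"
            using norm_diff_le_if_mem_cube[OF that] norm_triangle_ineq4[of "z - u" "z - y"]
            by (simp add: d_def)
          then have "(norm (y - u))\<^sup>2 \<le> (norm (z - u) + d)\<^sup>2" by (intro power_mono) auto
          also have "\<dots> \<le> 2 * (norm (z - u))\<^sup>2 + 2 * d\<^sup>2"
            using sum_squares_bound[of "norm (z - u)" d] by (simp add: power2_sum)
          finally have "a * ((norm (y - u))\<^sup>2) \<le> a * (2 * (norm (z - u))\<^sup>2 + 2 * d\<^sup>2)"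
            using a by (intro mult_left_mono) auto
          then show ?thesis
            unfolding k_def exp_add[symmetric] by (intro ennreal_leI) (simp add: algebra_simps)
        qed
        then show "ennreal (w z) * k z
            * J (z, y)
          \<le> ennreal (exp (a * d\<^sup>2) * exp (- (a / 2) * (norm (y - u))\<^sup>2))
            * (ennreal (w z) * indicator (cube s y) z)"
          by (auto split: split_indicator
            simp: J(2) mult.commute[of "ennreal (w z)"] intro!: mult_right_mono)
      qed
      also have "\<dots> = ennreal (exp (a * d\<^sup>2) * exp (- (a / 2) * (norm (y - u))\<^sup>2)) * W y"
        unfolding W_def emeasure_weighted_measure[OF w sets_cube(1)]
          by (rule nn_integral_cmult) measurable
      also have "\<dots> \<le> ennreal (exp (a * d\<^sup>2) * exp (- (a / 2) * (norm (y - u))\<^sup>2))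
          * (ennreal (A * exp (B * norm (y - u))) * W u)"
        unfolding W_def by (intro mult_left_mono growth) auto
      also have "\<dots> = ennreal (exp (a * d\<^sup>2) * A * exp (B * norm (y - u) - (a / 2)
        * (norm (y - u))\<^sup>2)) * W u"
      proof -
        have "exp (a * d\<^sup>2) * exp (- (a / 2) * (norm (y - u))\<^sup>2) * (A * exp (B * norm (y - u)))
          = exp (a * d\<^sup>2) * A * exp (B * norm (y - u) - (a / 2) * (norm (y - u))\<^sup>2)"
        proof -
          have "B * norm (y - u) - (a / 2) * (norm (y - u))\<^sup>2
              = - (a / 2) * (norm (y - u))\<^sup>2 + B * norm (y - u)" by simp
          then show ?thesis by (simp only: exp_add mult_ac)
        qed
        then show ?thesis using AB by (subst ennreal_mult_mult)
          (auto simp only: intro!: mult_nonneg_nonneg exp_ge_zero)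
      qed
      also have "\<dots> \<le> ennreal (c * exp (- (a / 4) * (norm (y - u))\<^sup>2)) * W u"
      proof -
        define t where "t = norm (y - u)"
        have "exp (B * t - a / 2 * t\<^sup>2) \<le> exp (B\<^sup>2 / a) * exp (- (a / 4) * t\<^sup>2)"
          using exp_linear_minus_quadratic_le[OF a, of B t] by (simp only: exp_add[symmetric]) simp
        then have "exp (a * d\<^sup>2) * A * exp (B * t - a / 2 * t\<^sup>2)
          \<le> exp (a * d\<^sup>2) * A * (exp (B\<^sup>2 / a) * exp (- (a / 4) * t\<^sup>2))"
          using AB by (intro mult_left_mono) auto
        then show ?thesis
          unfolding t_def c_def by (intro mult_right_mono ennreal_leI) (auto simp: mult.assoc)
      qed
      finally show "(\<integral>\<^sup>+ z. ennreal (w z) * k z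
        * J (z, y) \<partial>lebesgue)
        \<le> ennreal (c * exp (- (a / 4) * (norm (y - u))\<^sup>2)) * W u" .
    qed
    also have "\<dots> = ennreal c * (\<integral>\<^sup>+ y. ennreal (exp (- (a / 4) * (norm (y - u))\<^sup>2)) \<partial>lebesgue) * W u"
      using c by (simp add: nn_integral_multc nn_integral_cmult ennreal_mult measurable_completion)
    also have "\<dots> = ennreal (c * G) * W u"
      using a c G by (subst nn_integral_gaussian(1)) (auto simp: ennreal_mult)
    finally show ?thesis by (simp add: k_def)
  qed
  show ?thesis
  \<comment> \<open>\<open>c\<close> and \<open>G\<close> are only known to be nonnegative, so 1 is
    added to obtain a positive constant.\<close>
  proof (rule that[of "c * G / m + 1"])
    fix u
    define I where "I = (\<integral>\<^sup>+ z. ennreal (exp (- a * (norm (z - u))\<^sup>2)) \<partial>weighted_measure w)"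
    have "I = ennreal (1 / m) * (ennreal m * I)"
      using m by (simp add: mult.assoc[symmetric] ennreal_mult[symmetric])
    also have "\<dots> \<le> ennreal (1 / m) * (ennreal (c * G) * W u)"
      unfolding I_def by (intro mult_left_mono main) auto
    also have "\<dots> = ennreal (c * G / m) * W u"
      using m c G by (simp add: mult.assoc[symmetric] ennreal_mult[symmetric])
    also have "\<dots> \<le> ennreal (c * G / m + 1) * W u"
      by (intro mult_right_mono ennreal_leI) auto
    finally show "I \<le> ennreal (c * G / m + 1) * emeasure (weighted_measure w) (cube s u)"
      by (simp add: W_def)
  qed (use m c G in \<open>auto intro: add_nonneg_pos\<close>)
qed

section \<open>Change of scale and Gaussian convolution\<close>

lemma measurable_weighted_measure: "measurable (weighted_measure w) N = measurable lebesgue N"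
  by (rule measurable_cong_sets) auto

lemma measurable_emeasure_weighted_cube:
  fixes w :: "complex ^ 'n \<Rightarrow> real"
  assumes w: "weight w"
  shows "(\<lambda>u. emeasure (weighted_measure w) (cube s u)) \<in> borel_measurable lebesgue"
proof -
  note [measurable] = weight_measurable[OF w]
  define J :: "(complex ^ 'n) \<times> (complex ^ 'n) \<Rightarrow> ennreal"
    where "J = indicator {x. snd x \<in> cube s (fst x)}"
  have [measurable]: "J \<in> borel_measurable (lebesgue \<Otimes>\<^sub>M lebesgue)"
    unfolding J_def by (rule measurable_indicator_cube_rel)
  have eq: "emeasure (weighted_measure w) (cube s u) = (\<integral>\<^sup>+ y. ennreal (w y) * J (u, y) \<partial>lebesgue)" for u
    unfolding emeasure_weighted_measure[OF w sets_cube(1)]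
    by (intro nn_integral_cong) (auto simp: J_def split: split_indicator)
  show ?thesis unfolding eq
    by (rule lebesgue.borel_measurable_nn_integral) measurable
qed

text \<open>The bound concerns masses, not averages, so it passes to smaller concentric cubes with
  the same constant. It is applied with s = r/2, the side for which growth is controlled.\<close>

lemma A_class_imp_bounds_subcube:
  fixes w :: "complex ^ 'n \<Rightarrow> real"
  assumes "w \<in> A_class p r" "1 < p" "0 < r" "s \<le> r"
  obtains C where "0 < C"
    "\<And>z. emeasure (weighted_measure w) (cube s z) < \<infinity>"
    "\<And>z. emeasure (weighted_measure (dual_weight p w)) (cube s z) < \<infinity>"
    "\<And>z. measure (weighted_measure w) (cube s z)
      * measure (weighted_measure (dual_weight p w)) (cube s z) powr (p - 1) \<le> C"
proof -
  obtain C where C: "0 < C"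
    "\<And>z. emeasure (weighted_measure w) (cube r z) < \<infinity>"
    "\<And>z. emeasure (weighted_measure (dual_weight p w)) (cube r z) < \<infinity>"
    "\<And>z. measure (weighted_measure w) (cube r z)
      * measure (weighted_measure (dual_weight p w)) (cube r z) powr (p - 1) \<le> C"
    using A_class_imp_bounds[OF assms(1-3)] by metis
  have le: "emeasure (weighted_measure v) (cube s z) \<le> emeasure (weighted_measure v) (cube r z)"
    for v :: "complex ^ 'n \<Rightarrow> real" and z
    by (intro emeasure_mono cube_mono assms) simp
  have fin: "emeasure (weighted_measure w) (cube s z) < \<infinity>"
    "emeasure (weighted_measure (dual_weight p w)) (cube s z) < \<infinity>" for z
    using le_less_trans[OF le C(2)] le_less_trans[OF le C(3)] by blast+
  have "measure (weighted_measure w) (cube s z)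
      * measure (weighted_measure (dual_weight p w)) (cube s z) powr (p - 1)
    \<le> measure (weighted_measure w) (cube r z)
      * measure (weighted_measure (dual_weight p w)) (cube r z) powr (p - 1)" for z
    using le[of w z] le[of "dual_weight p w" z] C(2,3)[of z] assms(2)
    by (intro mult_mono powr_mono2) (auto simp: measure_def intro: enn2real_mono)
  with C(4) show ?thesis by (intro that[OF C(1) fin]) (rule order_trans)
qed

text \<open>Doubling compares cubes of side r/2 whose centres are at most r/4 apart; chaining such
  comparisons gives the rate \<open>B\<close>.\<close>

lemma A_class_cube_growth:
  fixes w :: "complex ^ 'n \<Rightarrow> real"
  assumes A: "w \<in> A_class p r" and p: "1 < p" and r: "0 < r"
  obtains A B where "0 < A" "0 \<le> B"
    "\<And>y u. measure (weighted_measure w) (cube (r / 2) y)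
      \<le> A * exp (B * norm (y - u)) * measure (weighted_measure w) (cube (r / 2) u)"
    "\<And>y u. emeasure (weighted_measure w) (cube (r / 2) y)
      \<le> ennreal (A * exp (B * norm (y - u))) * emeasure (weighted_measure w) (cube (r / 2) u)"
proof -
  obtain D where D: "1 \<le> D" "\<And>z u. norm (z - u) \<le> r / 2 / 2 \<Longrightarrow>
    measure (weighted_measure w) (cube (r / 2) z) \<le> D * measure (weighted_measure w) (cube (r / 2) u)"
    using A_class_doubling[of w p "r / 2"] A p r by auto
  have half: "r / 2 \<le> r" using r by simp
  have fin: "emeasure (weighted_measure w) (cube (r / 2) z) \<noteq> \<infinity>" for z
    using A_class_imp_bounds_subcube[OF A p r half] by (metis less_irrefl)
  define B where "B = ln D / (r / 2 / 2)"
  have 1: "measure (weighted_measure w) (cube (r / 2) y)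
      \<le> D * exp (B * norm (y - u)) * measure (weighted_measure w) (cube (r / 2) u)" for y u
    unfolding B_def by (rule exp_growth_of_local_comparison) (use D r in auto)
  show ?thesis
  proof (rule that[of D B])
    fix y u
    show "emeasure (weighted_measure w) (cube (r / 2) y)
      \<le> ennreal (D * exp (B * norm (y - u))) * emeasure (weighted_measure w) (cube (r / 2) u)"
      using 1[of y u] fin D(1) by
        (simp add: emeasure_eq_ennreal_measure ennreal_mult[symmetric] ennreal_le_iff)
  qed (use 1 D r in \<open>auto simp: B_def\<close>)
qed

lemma A_class_gaussian_bound:
  fixes w :: "complex ^ 'n \<Rightarrow> real"
  assumes A: "w \<in> A_class p r" and p: "1 < p" and r: "0 < r" and a: "0 < a"
  obtains C where "0 < C" "\<And>u. (\<integral>\<^sup>+ z. ennreal (exp (- a * (norm (z - u))\<^sup>2)) \<partial>weighted_measure w)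
    \<le> ennreal C * emeasure (weighted_measure w) (cube (r / 2) u)"
proof -
  have w: "weight w" using A by (simp add: A_class_def)
  obtain K B where KB: "0 < K" "0 \<le> B"
    "\<And>y u. emeasure (weighted_measure w) (cube (r / 2) y)
      \<le> ennreal (K * exp (B * norm (y - u))) * emeasure (weighted_measure w) (cube (r / 2) u)"
    using A_class_cube_growth[OF A p r] by metis
  show ?thesis
    by (rule gaussian_integral_le_cube_mass[OF w _ a _ KB(2,3)]) (use r KB(1) that in auto)
qed

text \<open>On a cube of any side the indicator is at most a constant times the Gaussian at the
  centre, and the Gaussian integral is already controlled by the mass at side r/2. No covering of
  the large cube by small ones is involved.\<close>

lemma A_class_cube_comparison:
  fixes w :: "complex ^ 'n \<Rightarrow> real"
  assumes A: "w \<in> A_class p r" and p: "1 < p" and r: "0 < r"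
  obtains C where "0 < C" "\<And>u. emeasure (weighted_measure w) (cube t u)
    \<le> ennreal C * emeasure (weighted_measure w) (cube (r / 2) u)"
proof -
  have w: "weight w" using A by (simp add: A_class_def)
  obtain C where C: "0 < C" "\<And>u. (\<integral>\<^sup>+ z. ennreal (exp (- 1 * (norm (z - u))\<^sup>2)) \<partial>weighted_measure w)
    \<le> ennreal C * emeasure (weighted_measure w) (cube (r / 2) u)"
    using A_class_gaussian_bound[OF A p r zero_less_one] by metis
  define d where "d = real CARD('n) * t"
  have "emeasure (weighted_measure w) (cube t u)
    \<le> ennreal (exp (d\<^sup>2) * C) * emeasure (weighted_measure w) (cube (r / 2) u)" for u
  proof -
    have "emeasure (weighted_measure w) (cube t u) = (\<integral>\<^sup>+ z. indicator (cube t u) z \<partial>weighted_measure w)"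
      by simp
    also have "\<dots> \<le> (\<integral>\<^sup>+ z. ennreal (exp (d\<^sup>2)) * ennreal (exp (- 1
      * (norm (z - u))\<^sup>2)) \<partial>weighted_measure w)"
    proof (rule nn_integral_mono)
      fix z
      have "1 \<le> exp (d\<^sup>2) * exp (- 1 * (norm (z - u))\<^sup>2)" if "z \<in> cube t u"
      proof -
        have "(norm (z - u))\<^sup>2 \<le> d\<^sup>2"
          using norm_diff_le_if_mem_cube[OF that] by (intro power_mono) (auto simp: d_def)
        then show ?thesis unfolding exp_add[symmetric] by simp
      qed
      then show "indicator (cube t u) z \<le> ennreal (exp (d\<^sup>2)) * ennreal (exp (- 1 * (norm (z - u))\<^sup>2))"
        by (auto split: split_indicator simp flip: ennreal_mult ennreal_1 simp del: ennreal_1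
          intro!: ennreal_leI)
    qed
    also have "\<dots> = ennreal (exp (d\<^sup>2)) * (\<integral>\<^sup>+ z. ennreal (exp (- 1
      * (norm (z - u))\<^sup>2)) \<partial>weighted_measure w)"
      by (rule nn_integral_cmult) (auto simp: measurable_weighted_measure intro!: measurable_completion)
    also have "\<dots> \<le> ennreal (exp (d\<^sup>2)) * (ennreal C * emeasure (weighted_measure w) (cube (r / 2) u))"
      by (intro mult_left_mono C) auto
    finally show ?thesis using C(1) by (simp add: ennreal_mult_mult)
  qed
  then show ?thesis using C(1) by (intro that[of "exp (d\<^sup>2) * C"]) auto
qed

text \<open>Compare the cube of side t with that of side r/2 twice: for w itself, and for sigma as a
  weight of the conjugate class. Both t < r and t > r are covered by the same estimate.\<close>

lemma A_class_change_scale: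
  fixes w :: "complex ^ 'n \<Rightarrow> real"
  assumes A: "w \<in> A_class p r" and p: "1 < p" and r: "0 < r" and t: "0 < t"
  shows "w \<in> A_class p t"
proof -
  define \<mu> where "\<mu> = weighted_measure w"
  define \<nu> where "\<nu> = weighted_measure (dual_weight p w)"
  have w: "weight w" using A by (simp add: A_class_def)
  have q: "1 < p / (p - 1)" using p by (simp add: field_simps)
  obtain C where C: "0 < C"
    "\<And>z. emeasure \<mu> (cube (r / 2) z) < \<infinity>" "\<And>z. emeasure \<nu> (cube (r / 2) z) < \<infinity>"
    "\<And>z. measure \<mu> (cube (r / 2) z) * measure \<nu> (cube (r / 2) z) powr (p - 1) \<le> C"
    unfolding \<mu>_def \<nu>_def by (rule A_class_imp_bounds_subcube[OF A p r, of "r / 2"]) (use r in auto)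
  obtain C1 where C1: "0 < C1" "\<And>u. emeasure \<mu> (cube t u) \<le> ennreal C1 * emeasure \<mu> (cube (r / 2) u)"
    using A_class_cube_comparison[OF A p r] unfolding \<mu>_def by metis
  obtain C2 where C2: "0 < C2" "\<And>u. emeasure \<nu> (cube t u) \<le> ennreal C2 * emeasure \<nu> (cube (r / 2) u)"
    using A_class_cube_comparison[OF A_class_dual_weight[OF A p r] q r] unfolding \<nu>_def by metis
  show ?thesis
  proof (rule A_classI[OF w p t, where C = "C1 * C2 powr (p - 1) * C"])
    fix z
    define W where "W = measure \<mu> (cube (r / 2) z)"
    define V where "V = measure \<nu> (cube (r / 2) z)"
    have nn: "0 \<le> W" "0 \<le> V" by (auto simp: W_def V_def)
    have WV: "emeasure \<mu> (cube (r / 2) z) = ennreal W" "emeasure \<nu> (cube (r / 2) z) = ennreal V"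
      using C(2,3)[of z] by (auto simp: W_def V_def emeasure_eq_ennreal_measure)
    have "emeasure \<mu> (cube t z) * ennreal_powr (emeasure \<nu> (cube t z)) (p - 1)
      \<le> ennreal (C1 * W) * ennreal_powr (ennreal (C2 * V)) (p - 1)"
      using C1(2)[of z] C2(2)[of z] C1(1) C2(1) p nn unfolding WV
      by (intro mult_mono ennreal_powr_mono) (auto simp: ennreal_mult)
    also have "\<dots> = ennreal (C1 * C2 powr (p - 1) * (W * V powr (p - 1)))"
      using C1(1) C2(1) nn by (simp add: ennreal_powr_ennreal ennreal_mult[symmetric] powr_mult mult_ac)
    also have "\<dots> \<le> ennreal (C1 * C2 powr (p - 1) * C)"
      using C1(1) C(4)[of z] by (intro ennreal_leI mult_left_mono) (auto simp: W_def V_def)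
    finally show "emeasure (weighted_measure w) (cube t z) *
        ennreal_powr (emeasure (weighted_measure (dual_weight p w)) (cube t z)) (p - 1)
        \<le> ennreal (C1 * C2 powr (p - 1) * C)"
      by (simp add: \<mu>_def \<nu>_def)
  qed
qed

text \<open>This is Schur's test: in Hoelder's inequality the kernel is split with the auxiliary factor
  \<open>V\<^bsup>(p-1)/p\<^esup>\<close>, where \<open>V u\<close> is the dual mass of the cube at \<open>u\<close>.\<close>

lemma A_class_gaussian_convolution_bound:
  fixes w :: "complex ^ 'n \<Rightarrow> real"
  assumes A: "w \<in> A_class p r" and p: "1 < p" and r: "0 < r" and \<alpha>: "0 < \<alpha>"
  shows "\<exists>C>0. \<forall>h\<in>borel_measurable lebesgue. (\<forall>u. 0 \<le> h u) \<longrightarrow>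
    (\<integral>\<^sup>+ z. ennreal_powr (\<integral>\<^sup>+ u. ennreal (exp (- (\<alpha> / 2)
      * (norm (z - u))\<^sup>2) * h u) \<partial>lebesgue) p \<partial>weighted_measure w)
      \<le> ennreal C * (\<integral>\<^sup>+ u. ennreal (h u powr p) \<partial>weighted_measure w)"
proof -
  define s where "s = r / 2"
  define \<sigma> where "\<sigma> = dual_weight p w"
  define \<mu> where "\<mu> = weighted_measure w"
  define \<nu> where "\<nu> = weighted_measure \<sigma>"
  have w: "weight w" using A by (simp add: A_class_def)
  have \<sigma>: "weight \<sigma>" using w by (simp add: \<sigma>_def weight_dual_weight)
  note [measurable] = weight_measurable[OF w] weight_measurable[OF \<sigma>]
  have s: "0 < s" using r by (simp add: s_def)
  have q: "1 < p / (p - 1)" using p by (simp add: field_simps)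
  note A' = A_class_dual_weight[OF A p r]
  obtain C0 where C0: "0 < C0"
    "\<And>z. emeasure \<mu> (cube s z) < \<infinity>" "\<And>z. emeasure \<nu> (cube s z) < \<infinity>"
    "\<And>z. measure \<mu> (cube s z) * measure \<nu> (cube s z) powr (p - 1) \<le> C0"
    unfolding \<mu>_def \<nu>_def \<sigma>_def s_def by (rule A_class_imp_bounds_subcube[OF A p r, of "r / 2"])
      (use r in auto)
  obtain K B where KB: "0 < K" "0 \<le> B"
    "\<And>y u. measure \<nu> (cube s y) \<le> K * exp (B * norm (y - u)) * measure \<nu> (cube s u)"
    using A_class_cube_growth[OF A' q r] unfolding \<nu>_def \<sigma>_def s_def by metis
  obtain C1 where C1: "0 < C1" "\<And>u. (\<integral>\<^sup>+ z. ennreal (exp (- (\<alpha> / 4) * (norm (z - u))\<^sup>2)) \<partial>\<nu>)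
      \<le> ennreal C1 * emeasure \<nu> (cube s u)"
    using A_class_gaussian_bound[OF A' q r, of "\<alpha> / 4"] \<alpha> unfolding \<nu>_def \<sigma>_def s_def by auto
  obtain C2 where C2: "0 < C2" "\<And>u. (\<integral>\<^sup>+ z. ennreal (exp (- (\<alpha> / 2) * (norm (z - u))\<^sup>2)) \<partial>\<mu>)
      \<le> ennreal C2 * emeasure \<mu> (cube s u)"
    using A_class_gaussian_bound[OF A p r, of "\<alpha> / 2"] \<alpha> unfolding \<mu>_def s_def by auto
  define V where "V u = measure \<nu> (cube s u)" for u
  have V: "emeasure \<nu> (cube s u) = ennreal (V u)" for u
    using C0(3)[of u] by (simp add: V_def emeasure_eq_ennreal_measure)
  have Vpos: "0 < V u" for u
    using emeasure_weighted_cube_pos[OF \<sigma> s, of u] V[of u] by (simp add: \<nu>_def)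
  have [measurable]: "V \<in> borel_measurable lebesgue"
    unfolding V_def measure_def \<nu>_def
    by (intro borel_measurable_enn2real measurable_emeasure_weighted_cube \<sigma>)
  define k where "k z u = exp (- (\<alpha> / 2) * (norm (z - u))\<^sup>2)" for z u :: "complex ^ 'n"
  have kpos: "0 < k z u" for z u by (simp add: k_def)
  have k1[measurable]: "k z \<in> borel_measurable lebesgue" "(\<lambda>z. k z u) \<in> borel_measurable lebesgue" for z u
    unfolding k_def by (auto intro!: measurable_completion)
  have k2[measurable]: "(\<lambda>x. k (fst x) (snd x)) \<in> borel_measurable (lebesgue \<Otimes>\<^sub>M lebesgue)"
    unfolding k_def by (intro measurable_lebesgue_pair borel_measurable_continuous_onI continuous_intros)
  have kk: "k z u = k u z" for z u by (simp add: k_def norm_minus_commute)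
  define c where "c = K * exp (B\<^sup>2 / \<alpha>) * C1"
  have c: "0 < c" using KB C1 by (simp add: c_def)
  \<comment> \<open>The uniform half of Schur's test. Exponential growth gives k(z,u)/V(u) at most a
    constant times a wider Gaussian divided by V(z), and the integral of that Gaussian against sigma
    returns V(z).\<close>
  have dual: "(\<integral>\<^sup>+ u. ennreal (k z u / V u * \<sigma> u) \<partial>lebesgue) \<le> ennreal c" for z
  proof -
    have "(\<integral>\<^sup>+ u. ennreal (k z u / V u * \<sigma> u) \<partial>lebesgue) = (\<integral>\<^sup>+ u. ennreal (k z u / V u) \<partial>\<nu>)"
      unfolding \<nu>_def using kpos Vpos
      by (subst nn_integral_weighted_measure[OF \<sigma>])
        (auto intro!: nn_integral_cong
          simp: ennreal_mult'[symmetric] ennreal_mult''[symmetric] less_imp_le mult.commute)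
    also have "\<dots> \<le> (\<integral>\<^sup>+ u. ennreal (K * exp (B\<^sup>2 / \<alpha>) / V z) * ennreal (exp (- (\<alpha> / 4)
      * (norm (u - z))\<^sup>2)) \<partial>\<nu>)"
    proof (rule nn_integral_mono)
      fix u
      have "k z u * V z \<le> k z u * (K * exp (B * norm (z - u)) * V u)"
        using KB(3)[of z u] kpos[of z u] by (intro mult_left_mono) (auto simp: V_def)
      also have "\<dots> = K * (exp (B * norm (z - u)) * exp (- (\<alpha> / 2) * (norm (z - u))\<^sup>2)) * V u"
        by (simp only: k_def mult_ac)
      also have "\<dots> \<le> K * (exp (B\<^sup>2 / \<alpha>) * exp (- (\<alpha> / 4) * (norm (z - u))\<^sup>2)) * V u"
        using KB Vpos[of u] by (intro mult_left_mono mult_right_mono exp_linear_minus_quadratic_le \<alpha>) auto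
      finally have "k z u / V u \<le> K * exp (B\<^sup>2 / \<alpha>) / V z * exp (- (\<alpha> / 4) * (norm (z - u))\<^sup>2)"
        using Vpos by (simp add: divide_simps mult_ac)
      then show "ennreal (k z u / V u)
        \<le> ennreal (K * exp (B\<^sup>2 / \<alpha>) / V z) * ennreal (exp (- (\<alpha> / 4) * (norm (u - z))\<^sup>2))"
        using KB(1) Vpos[of z]
        by (subst ennreal_mult[symmetric])
          (auto intro!: ennreal_leI simp: norm_minus_commute less_imp_le)
    qed
    also have "\<dots> = ennreal (K * exp (B\<^sup>2 / \<alpha>) / V z) * (\<integral>\<^sup>+ u. ennreal (exp (- (\<alpha> / 4)
      * (norm (u - z))\<^sup>2)) \<partial>\<nu>)"
      unfolding \<nu>_def by (rule nn_integral_cmult)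
        (auto simp: measurable_weighted_measure intro!: measurable_completion)
    also have "\<dots> \<le> ennreal (K * exp (B\<^sup>2 / \<alpha>) / V z) * (ennreal C1 * ennreal (V z))"
      using C1(2)[of z] unfolding V by (intro mult_left_mono) auto
    also have "\<dots> = ennreal (K * exp (B\<^sup>2 / \<alpha>) / V z * (C1 * V z))"
      using KB(1) C1(1) Vpos[of z] by (simp add: ennreal_mult[symmetric] less_imp_le)
    also have "K * exp (B\<^sup>2 / \<alpha>) / V z * (C1 * V z) = c"
      using Vpos[of z] by (simp add: c_def)
    finally show ?thesis .
  qed
  show ?thesis
  proof (intro exI[of _ "c powr (p - 1) * (C2 * C0)"] conjI ballI impI)
    show "0 < c powr (p - 1) * (C2 * C0)" using c C2 C0 by simp
  next
    fix h :: "complex ^ 'n \<Rightarrow> real"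
    assume h[measurable]: "h \<in> borel_measurable lebesgue" and "\<forall>u. 0 \<le> h u"
    then have hn: "0 \<le> h u" for u by blast
    have pt: "ennreal_powr (\<integral>\<^sup>+ u. ennreal (k z u * h u) \<partial>lebesgue) p
      \<le> ennreal (c powr (p - 1)) * (\<integral>\<^sup>+ u. ennreal (k z u * V u powr (p - 1)
        * (w u * h u powr p)) \<partial>lebesgue)" for z
    proof -
      \<comment> \<open>The factors multiply to k h because w^(1/p) sigma^((p-1)/p) = 1 a.e., and
        the powers of V cancel. The conjugate power of \<open>g\<close> is the integrand of
        \<open>dual\<close>, which explains the exponents in both factors.\<close>
      define f where "f u = (k z u * V u powr (p - 1) * w u) powr (1 / p) * h u" for u
      define g where "g u = (k z u / V u * \<sigma> u) powr ((p - 1) / p)" for u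
      have ae: "AE u in lebesgue. k z u * h u = f u * g u \<and>
          f u powr p = k z u * V u powr (p - 1) * (w u * h u powr p) \<and>
          g u powr (p / (p - 1)) = k z u / V u * \<sigma> u"
        using weight_pos[OF w] weight_pos[OF \<sigma>]
      proof eventually_elim
        case (elim u)
        have "1 / p + (p - 1) / p = 1" using p by (simp add: field_simps)
        then have 1: "k z u powr (1 / p) * k z u powr ((p - 1) / p) = k z u"
          using kpos[of z u] by (simp add: powr_add[symmetric])
        have 2: "w u powr (1 / p) * \<sigma> u powr ((p - 1) / p) = 1"
          unfolding \<sigma>_def dual_weight_def using p elim by (simp add: powr_powr powr_add[symmetric])
        have "f u * g u = (k z u powr (1 / p) * k z u powr ((p - 1) / p)) *
            (w u powr (1 / p) * \<sigma> u powr ((p - 1) / p)) * h u"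
          using p elim kpos[of z u] Vpos[of u]
          by (simp add: f_def g_def powr_mult powr_divide powr_powr)
        with 1 2 have a: "k z u * h u = f u * g u" by simp
        have b: "f u powr p = k z u * V u powr (p - 1) * (w u * h u powr p)"
          using p elim kpos[of z u] Vpos[of u] hn[of u] by (simp add: f_def powr_mult powr_powr)
        have c: "g u powr (p / (p - 1)) = k z u / V u * \<sigma> u"
          using p elim kpos[of z u] Vpos[of u] by (simp add: g_def powr_powr)
        show ?case using a b c by blast
      qed
      have eqs: "(\<integral>\<^sup>+ u. ennreal (k z u * h u) \<partial>lebesgue) = (\<integral>\<^sup>+ u. ennreal (f u * g u) \<partial>lebesgue)"
        "(\<integral>\<^sup>+ u. ennreal (f u powr p) \<partial>lebesgue)
          = (\<integral>\<^sup>+ u. ennreal (k z u * V u powr (p - 1) * (w u * h u powr p)) \<partial>lebesgue)"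
        "(\<integral>\<^sup>+ u. ennreal (g u powr (p / (p - 1))) \<partial>lebesgue)
          = (\<integral>\<^sup>+ u. ennreal (k z u / V u * \<sigma> u) \<partial>lebesgue)"
        by (rule nn_integral_cong_AE, rule eventually_mono[OF ae], simp)+
      have "ennreal_powr (\<integral>\<^sup>+ u. ennreal (f u * g u) \<partial>lebesgue) p
          \<le> (\<integral>\<^sup>+ u. ennreal (f u powr p) \<partial>lebesgue)
            * ennreal_powr (\<integral>\<^sup>+ u. ennreal (g u powr (p / (p - 1))) \<partial>lebesgue) (p - 1)"
        by (rule Holder_nn_integral) (use p hn in \<open>auto simp: f_def g_def\<close>)
      also have "\<dots> \<le> (\<integral>\<^sup>+ u. ennreal (f u powr p) \<partial>lebesgue) * ennreal_powr (ennreal c) (p - 1)"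
        using p dual[of z] unfolding eqs by (intro mult_left_mono ennreal_powr_mono) auto
      finally show ?thesis
        using c unfolding eqs by (simp add: ennreal_powr_ennreal mult.commute)
    qed
    have "(\<integral>\<^sup>+ z. ennreal_powr (\<integral>\<^sup>+ u. ennreal (k z u * h u) \<partial>lebesgue) p \<partial>\<mu>)
      \<le> (\<integral>\<^sup>+ z. ennreal (c powr (p - 1)) * (\<integral>\<^sup>+ u. ennreal (k z u * V u powr (p - 1)
        * (w u * h u powr p)) \<partial>lebesgue) \<partial>\<mu>)"
      by (intro nn_integral_mono pt)
    also have "\<dots> = (\<integral>\<^sup>+ z. ennreal (w z) * (ennreal (c powr (p - 1))
      * (\<integral>\<^sup>+ u. ennreal (k z u * V u powr (p - 1) * (w u * h u powr p)) \<partial>lebesgue)) \<partial>lebesgue)"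
      unfolding \<mu>_def by (rule nn_integral_weighted_measure[OF w]) measurable
    also have "\<dots> = (\<integral>\<^sup>+ z. (\<integral>\<^sup>+ u. ennreal (c powr (p - 1))
      * (ennreal (w z) * ennreal (k z u * V u powr (p - 1) * (w u * h u powr p))) \<partial>lebesgue) \<partial>lebesgue)"
      by (simp add: nn_integral_cmult mult.left_commute)
    also have "\<dots> = (\<integral>\<^sup>+ u. (\<integral>\<^sup>+ z. ennreal (c powr (p - 1))
      * (ennreal (w z) * ennreal (k z u * V u powr (p - 1) * (w u * h u powr p))) \<partial>lebesgue) \<partial>lebesgue)"
      by (intro lebesgue_pair.Fubini'[symmetric]) (simp add: split_beta')
    also have "\<dots> \<le> (\<integral>\<^sup>+ u. ennreal (c powr (p - 1) * (C2 * C0))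
      * (ennreal (w u) * ennreal (h u powr p)) \<partial>lebesgue)"
    \<comment> \<open>For fixed u, the z-integral of the kernel against w is at most C2 W(u). The
      factor V(u)^(p-1) left by Hoelder's inequality then completes the product W(u) V(u)^(p-1),
      which is at most C0.\<close>
    proof (intro nn_integral_mono_AE eventually_mono[OF weight_pos[OF w]])
      fix u :: "complex ^ 'n" assume wu: "0 < w u"
      define b where "b = V u powr (p - 1) * (w u * h u powr p)"
      have b: "0 \<le> b" using wu hn by (simp add: b_def)
      have "(\<integral>\<^sup>+ z. ennreal (c powr (p - 1)) * (ennreal (w z) * ennreal (k z u * V u powr (p - 1)
        * (w u * h u powr p))) \<partial>lebesgue)
        = (\<integral>\<^sup>+ z. (ennreal (c powr (p - 1)) * ennreal b) * (ennreal (w z) * ennreal (k z u)) \<partial>lebesgue)"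
      proof (rule nn_integral_cong)
        fix z
        have "k z u * V u powr (p - 1) * (w u * h u powr p) = k z u * b" by (simp add: b_def)
        then have "ennreal (k z u * V u powr (p - 1) * (w u * h u powr p)) = ennreal (k z u) * ennreal b"
          using kpos[of z u] b by (simp only: ennreal_mult less_imp_le)
        then show "ennreal (c powr (p - 1)) * (ennreal (w z) * ennreal (k z u * V u powr (p - 1)
          * (w u * h u powr p)))
          = (ennreal (c powr (p - 1)) * ennreal b) * (ennreal (w z) * ennreal (k z u))"
          by (simp only: mult_ac)
      qed
      also have "\<dots> = (ennreal (c powr (p - 1)) * ennreal b) * (\<integral>\<^sup>+ z. ennreal (k z u) \<partial>\<mu>)"
        unfolding \<mu>_def by (simp add: nn_integral_cmult nn_integral_weighted_measure[OF w])
      also have "\<dots> \<le> (ennreal (c powr (p - 1)) * ennreal b) * (ennreal C2 * emeasure \<mu> (cube s u))"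
        using C2(2)[of u] unfolding k_def by (intro mult_left_mono) auto
      also have "\<dots> = ennreal (c powr (p - 1) * b * (C2 * measure \<mu> (cube s u)))"
        using C0(2)[of u] C2(1) b by (simp add: emeasure_eq_ennreal_measure ennreal_mult)
      also have "c powr (p - 1) * b * (C2 * measure \<mu> (cube s u))
          = c powr (p - 1) * C2 * (w u * h u powr p) * (measure \<mu> (cube s u) * V u powr (p - 1))"
        by (simp add: b_def mult_ac)
      also have "ennreal \<dots> \<le> ennreal (c powr (p - 1) * C2 * (w u * h u powr p) * C0)"
        using C0(4)[of u] C2(1) wu unfolding V_def by (intro ennreal_leI mult_left_mono) auto
      also have "\<dots> = ennreal (c powr (p - 1) * (C2 * C0)) * (ennreal (w u) * ennreal (h u powr p))"
        using C2(1) C0(1) wu by (simp add: ennreal_mult[symmetric] mult_ac)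
      finally show "(\<integral>\<^sup>+ z. ennreal (c powr (p - 1))
        * (ennreal (w z) * ennreal (k z u * V u powr (p - 1) * (w u * h u powr p))) \<partial>lebesgue)
        \<le> ennreal (c powr (p - 1) * (C2 * C0)) * (ennreal (w u) * ennreal (h u powr p))" .
    qed
    also have "\<dots> = ennreal (c powr (p - 1) * (C2 * C0)) * (\<integral>\<^sup>+ u. ennreal (h u powr p) \<partial>\<mu>)"
      unfolding \<mu>_def by (simp add: nn_integral_cmult nn_integral_weighted_measure[OF w])
    finally show "(\<integral>\<^sup>+ z. ennreal_powr (\<integral>\<^sup>+ u. ennreal (exp (- (\<alpha> / 2)
      * (norm (z - u))\<^sup>2) * h u) \<partial>lebesgue) p \<partial>weighted_measure w)
      \<le> ennreal (c powr (p - 1) * (C2 * C0)) * (\<integral>\<^sup>+ u. ennreal (h u powr p) \<partial>weighted_measure w)"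
      by (simp add: k_def \<mu>_def)
  qed
qed

section \<open>Boundedness of the integral operators\<close>

lemma Lp_space_iff_nn_integral:
  "f \<in> Lp_space p M \<longleftrightarrow> f \<in> borel_measurable M \<and> (\<integral>\<^sup>+ x. ennreal (norm (f x) powr p) \<partial>M) < \<infinity>"
  by (auto simp: Lp_space_def integrable_iff_bounded)

lemma Lp_norm_nonneg: "0 \<le> Lp_norm p M f"
  by (simp add: Lp_norm_def)

lemma nn_integral_eq_Lp_norm:
  assumes "0 < p" "f \<in> Lp_space p M"
  shows "(\<integral>\<^sup>+ x. ennreal (norm (f x) powr p) \<partial>M) = ennreal (Lp_norm p M f powr p)"
proof -
  have "(\<integral>\<^sup>+ x. ennreal (norm (f x) powr p) \<partial>M) = ennreal (LINT x|M. norm (f x) powr p)"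
    using assms by (intro nn_integral_eq_integral) (auto simp: Lp_space_def)
  also have "(LINT x|M. norm (f x) powr p) = Lp_norm p M f powr p"
    using assms by (simp add: Lp_norm_def powr_powr)
  finally show ?thesis .
qed

text \<open>One inequality between integrals in [0, infinity] yields both facts: finiteness of its
  right side gives membership, and the p-th root gives the norm estimate.\<close>

lemma Lp_space_dominated:
  assumes p: "0 < p" and f: "f \<in> Lp_space p M" and g: "g \<in> borel_measurable M" and C: "0 \<le> C"
    and le: "(\<integral>\<^sup>+ x. ennreal (norm (g x) powr p) \<partial>M)
      \<le> ennreal C * (\<integral>\<^sup>+ x. ennreal (norm (f x) powr p) \<partial>M)"
  shows "g \<in> Lp_space p M" "Lp_norm p M g \<le> C powr (1 / p) * Lp_norm p M f"
proof -
  have le': "(\<integral>\<^sup>+ x. ennreal (norm (g x) powr p) \<partial>M) \<le> ennreal (C * Lp_norm p M f powr p)"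
    using le C unfolding nn_integral_eq_Lp_norm[OF p f] by (simp add: ennreal_mult)
  then show g': "g \<in> Lp_space p M"
    using g by (auto simp: Lp_space_iff_nn_integral intro: le_less_trans)
  have "Lp_norm p M g powr p \<le> C * Lp_norm p M f powr p"
    using le' C unfolding nn_integral_eq_Lp_norm[OF p g'] by (simp add: ennreal_le_iff)
  then have "(Lp_norm p M g powr p) powr (1 / p) \<le> (C * Lp_norm p M f powr p) powr (1 / p)"
    using p by (intro powr_mono2) auto
  then show "Lp_norm p M g \<le> C powr (1 / p) * Lp_norm p M f"
    using p C Lp_norm_nonneg[of p M g] Lp_norm_nonneg[of p M f] by (simp add: powr_mult powr_powr)
qed

lemma measurable_integral_op:
  assumes K: "(\<lambda>x. K (fst x) (snd x)) \<in> borel_measurable borel" and f: "f \<in> borel_measurable lebesgue"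
  shows "integral_op K f \<in> borel_measurable lebesgue"
proof -
  note [measurable] = measurable_lebesgue_pair[OF K] f
  show ?thesis unfolding integral_op_def
    by (rule lebesgue.borel_measurable_lebesgue_integral) (simp add: split_beta')
qed

lemma measurable_kernel_section:
  fixes K :: "complex ^ 'n \<Rightarrow> complex ^ 'n \<Rightarrow> complex"
  assumes K: "(\<lambda>x. K (fst x) (snd x)) \<in> borel_measurable borel"
  shows "K z \<in> borel_measurable lebesgue"
proof -
  have "(\<lambda>u. (z, u)) \<in> measurable borel (borel :: ((complex ^ 'n) \<times> (complex ^ 'n)) measure)"
    by (intro borel_measurable_continuous_onI continuous_intros)
  from measurable_compose[OF this K] show ?thesis
    by (intro measurable_completion) simp
qed

lemma measurable_gauss_kernel: "(\<lambda>x. gauss_kernel \<alpha> (fst x) (snd x)) \<in> borel_measurable borel"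
  unfolding gauss_kernel_def by (intro borel_measurable_continuous_onI continuous_intros)

lemma measurable_fock_kernel: "(\<lambda>x. fock_kernel \<alpha> (fst x) (snd x)) \<in> borel_measurable borel"
  unfolding fock_kernel_def hermitian_dot_def
  by (intro borel_measurable_continuous_onI continuous_intros)

lemma measurable_gauss_mult:
  assumes "f \<in> borel_measurable lebesgue"
  shows "gauss_mult \<alpha> f \<in> borel_measurable lebesgue"
proof -
  have "(\<lambda>z :: complex ^ 'n. complex_of_real (exp (- (\<alpha> / 2) * (norm z)\<^sup>2))) \<in> borel_measurable lebesgue"
    by (intro measurable_completion) simp
  with assms show ?thesis unfolding gauss_mult_def by measurable
qed

text \<open>The convolution bound is applied to |f|. It controls the integral of absolute values,
  which yields absolute convergence a.e. and dominates the operator at once.\<close>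

lemma A_class_imp_H_bounded:
  fixes w :: "complex ^ 'n \<Rightarrow> real"
  assumes A: "w \<in> A_class p r" and p: "1 < p" and r: "0 < r" and \<alpha>: "0 < \<alpha>"
  shows "H_bounded \<alpha> p w"
proof -
  have w: "weight w" using A by (simp add: A_class_def)
  obtain C where C: "0 < C" "\<forall>h\<in>borel_measurable lebesgue. (\<forall>u. 0 \<le> h u) \<longrightarrow>
    (\<integral>\<^sup>+ z. ennreal_powr (\<integral>\<^sup>+ u. ennreal (exp (- (\<alpha> / 2)
      * (norm (z - u))\<^sup>2) * h u) \<partial>lebesgue) p \<partial>weighted_measure w)
      \<le> ennreal C * (\<integral>\<^sup>+ u. ennreal (h u powr p) \<partial>weighted_measure w)"
    using A_class_gaussian_convolution_bound[OF A p r \<alpha>] by blast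
  have *: "(AE z in lebesgue. integrable lebesgue (\<lambda>u. gauss_kernel \<alpha> z u * f u)) \<and>
      integral_op (gauss_kernel \<alpha>) f \<in> Lp_space p (weighted_measure w) \<and>
      Lp_norm p (weighted_measure w) (integral_op (gauss_kernel \<alpha>) f)
        \<le> C powr (1 / p) * Lp_norm p (weighted_measure w) f"
    if f: "f \<in> Lp_space p (weighted_measure w)" for f
  proof -
    have fm[measurable]: "f \<in> borel_measurable lebesgue"
      using f by (simp add: Lp_space_def measurable_weighted_measure)
    note [measurable] = measurable_lebesgue_pair[OF measurable_gauss_kernel]
      measurable_kernel_section[OF measurable_gauss_kernel]
    \<comment> \<open>This majorant may be infinite at some z; integrability of its p-th power makes
      it finite a.e.\<close>
    define I where "I z = (\<integral>\<^sup>+ u. ennreal (norm (gauss_kernel \<alpha> z u * f u)) \<partial>lebesgue)" for z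
    have [measurable]: "I \<in> borel_measurable lebesgue"
      unfolding I_def by (rule lebesgue.borel_measurable_nn_integral) (simp add: split_beta')
    have le: "(\<integral>\<^sup>+ z. ennreal_powr (I z) p \<partial>weighted_measure w)
        \<le> ennreal C * (\<integral>\<^sup>+ u. ennreal (norm (f u) powr p) \<partial>weighted_measure w)"
      using C(2)[rule_format, of "\<lambda>u. norm (f u)"] by (simp add: I_def gauss_kernel_def norm_mult)
    also have "\<dots> < \<infinity>"
      using f by (simp add: Lp_space_iff_nn_integral ennreal_mult_less_top)
    finally have "AE z in weighted_measure w. ennreal_powr (I z) p \<noteq> \<infinity>"
      by (intro nn_integral_PInf_AE) (auto simp: measurable_weighted_measure)
    then have "AE z in lebesgue. I z < \<infinity>"
      unfolding AE_weighted_measure[OF w]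
      by (auto elim!: eventually_mono simp: less_top[symmetric] ennreal_powr_less_top)
    then have int: "AE z in lebesgue. integrable lebesgue (\<lambda>u. gauss_kernel \<alpha> z u * f u)"
      by (rule eventually_mono) (auto intro!: integrableI_bounded simp: I_def)
    have meas: "integral_op (gauss_kernel \<alpha>) f \<in> borel_measurable (weighted_measure w)"
      by (simp add: measurable_weighted_measure measurable_integral_op measurable_gauss_kernel)
    have "(\<integral>\<^sup>+ z. ennreal (norm (integral_op (gauss_kernel \<alpha>) f z) powr p) \<partial>weighted_measure w)
      \<le> (\<integral>\<^sup>+ z. ennreal_powr (I z) p \<partial>weighted_measure w)"
    proof (rule nn_integral_mono_AE, unfold AE_weighted_measure[OF w], rule eventually_mono[OF int])
      fix z assume "integrable lebesgue (\<lambda>u. gauss_kernel \<alpha> z u * f u)"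
      then have "ennreal (norm (integral_op (gauss_kernel \<alpha>) f z)) \<le> I z"
        unfolding integral_op_def I_def by (rule integral_norm_bound_ennreal)
      then have "ennreal_powr (ennreal (norm (integral_op (gauss_kernel \<alpha>) f z))) p
        \<le> ennreal_powr (I z) p"
        using p by (intro ennreal_powr_mono) auto
      then show "ennreal (norm (integral_op (gauss_kernel \<alpha>) f z) powr p) \<le> ennreal_powr (I z) p"
        by (simp add: ennreal_powr_ennreal)
    qed
    also note le
    finally show ?thesis
      using int C(1) p Lp_space_dominated[OF _ f meas, of C] by auto
  qed
  then show ?thesis
    unfolding H_bounded_def bounded_integral_op_def by blast
qed

section \<open>Domination of the Fock projection by the Gaussian convolution\<close>

lemma Re_hermitian_dot: "Re (hermitian_dot z u) = z \<bullet> u"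
  by (simp add: hermitian_dot_def inner_vec_def inner_complex_def)

text \<open>The Gaussian in z on the left belongs to the norm of the image; the one in u on the
  right turns the argument f into \<open>gauss_mult\<close>. What remains is the convolution
  kernel.\<close>

lemma norm_fock_kernel:
  fixes z u :: "complex ^ 'n"
  assumes "0 < \<alpha>"
  shows "norm (fock_kernel \<alpha> z u) * exp (- (\<alpha> / 2) * (norm z)\<^sup>2)
    = (\<alpha> / pi) ^ CARD('n) * (exp (- (\<alpha> / 2) * (norm (z - u))\<^sup>2) * exp (- (\<alpha> / 2) * (norm u)\<^sup>2))"
proof -
  have norm_diff: "(norm (z - u))\<^sup>2 = (norm z)\<^sup>2 + (norm u)\<^sup>2 - 2 * (z \<bullet> u)"
    by (simp add: power2_norm_eq_inner inner_diff inner_commute)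
  have "\<alpha> * (z \<bullet> u) + - \<alpha> * (norm u)\<^sup>2 + - (\<alpha> / 2) * (norm z)\<^sup>2
      = - (\<alpha> / 2) * (norm (z - u))\<^sup>2 + - (\<alpha> / 2) * (norm u)\<^sup>2"
    unfolding norm_diff by (simp add: algebra_simps)
  then have "exp (\<alpha> * (z \<bullet> u)) * exp (- \<alpha> * (norm u)\<^sup>2) * exp (- (\<alpha> / 2) * (norm z)\<^sup>2)
      = exp (- (\<alpha> / 2) * (norm (z - u))\<^sup>2) * exp (- (\<alpha> / 2) * (norm u)\<^sup>2)"
    unfolding exp_add[symmetric] by (rule arg_cong)
  then show ?thesis
    using assms by (simp add: fock_kernel_def norm_mult norm_power norm_divide Re_hermitian_dot mult.assoc)
qed

lemma H_bounded_imp_P_bounded: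
  fixes w :: "complex ^ 'n \<Rightarrow> real"
  assumes H: "H_bounded \<alpha> p w" and w: "weight w" and p: "1 < p" and \<alpha>: "0 < \<alpha>"
  shows "P_bounded \<alpha> p w"
proof -
  obtain C where H1: "\<And>f. f \<in> Lp_space p (weighted_measure w) \<Longrightarrow>
      AE z in lebesgue. integrable lebesgue (\<lambda>u. gauss_kernel \<alpha> z u * f u)"
    and H2: "\<And>f. f \<in> Lp_space p (weighted_measure w) \<Longrightarrow>
      integral_op (gauss_kernel \<alpha>) f \<in> Lp_space p (weighted_measure w) \<and>
      Lp_norm p (weighted_measure w) (integral_op (gauss_kernel \<alpha>) f)
        \<le> C * Lp_norm p (weighted_measure w) f"
    using H unfolding H_bounded_def bounded_integral_op_def by blast
  define c where "c = (\<alpha> / pi) ^ CARD('n)"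
  have c: "0 < c" using \<alpha> by (simp add: c_def)
  have *: "(AE z in lebesgue. integrable lebesgue (\<lambda>u. fock_kernel \<alpha> z u * f u)) \<and>
      integral_op (fock_kernel \<alpha>) f \<in> Fock_Lp_space \<alpha> p w \<and>
      Fock_Lp_norm \<alpha> p w (integral_op (fock_kernel \<alpha>) f) \<le> c * C * Fock_Lp_norm \<alpha> p w f"
    if f: "f \<in> Fock_Lp_space \<alpha> p w" for f
  proof -
    have fm[measurable]: "f \<in> borel_measurable lebesgue"
      and gf: "gauss_mult \<alpha> f \<in> Lp_space p (weighted_measure w)"
      using f by (auto simp: Fock_Lp_space_def)
    note [measurable] = measurable_gauss_mult[OF fm] measurable_kernel_section[OF measurable_fock_kernel]
    \<comment> \<open>The modulus is taken because the triangle inequality discards the phases of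
      both the Fock kernel and f.\<close>
    define g where "g u = complex_of_real (norm (gauss_mult \<alpha> f u))" for u
    have [measurable]: "g \<in> borel_measurable lebesgue" unfolding g_def by measurable
    have g: "g \<in> Lp_space p (weighted_measure w)"
      using gf by (auto simp: Lp_space_iff_nn_integral measurable_weighted_measure) (simp add: g_def)
    have gnorm: "Lp_norm p (weighted_measure w) g = Fock_Lp_norm \<alpha> p w f"
      by (simp add: Lp_norm_def Fock_Lp_norm_def g_def)
    have pt: "norm (fock_kernel \<alpha> z u * f u) * exp (- (\<alpha> / 2) * (norm z)\<^sup>2)
      = c * norm (gauss_kernel \<alpha> z u * g u)" for z u
    proof -
      have "norm (fock_kernel \<alpha> z u * f u) * exp (- (\<alpha> / 2) * (norm z)\<^sup>2)
        = norm (fock_kernel \<alpha> z u) * exp (- (\<alpha> / 2) * (norm z)\<^sup>2) * norm (f u)"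
        by (simp add: norm_mult)
      also have "\<dots> = c * norm (gauss_kernel \<alpha> z u * g u)"
        unfolding norm_fock_kernel[OF \<alpha>]
        by (simp add: c_def g_def gauss_kernel_def gauss_mult_def norm_mult)
      finally show ?thesis .
    qed
    have intH: "AE z in lebesgue. integrable lebesgue (\<lambda>u. gauss_kernel \<alpha> z u * g u)"
      by (rule H1[OF g])
    have int: "integrable lebesgue (\<lambda>u. fock_kernel \<alpha> z u * f u)"
      if "integrable lebesgue (\<lambda>u. gauss_kernel \<alpha> z u * g u)" for z
    proof (rule Bochner_Integration.integrable_bound)
      show "integrable lebesgue (\<lambda>u. (c / exp (- (\<alpha> / 2)
        * (norm z)\<^sup>2)) * norm (gauss_kernel \<alpha> z u * g u))"
        using that by (intro integrable_mult_right integrable_norm)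
      show "AE u in lebesgue. norm (fock_kernel \<alpha> z u * f u)
        \<le> norm ((c / exp (- (\<alpha> / 2) * (norm z)\<^sup>2)) * norm (gauss_kernel \<alpha> z u * g u))"
      proof (rule AE_I2)
        fix u
        have "norm (fock_kernel \<alpha> z u * f u)
          = (c / exp (- (\<alpha> / 2) * (norm z)\<^sup>2)) * norm (gauss_kernel \<alpha> z u * g u)"
          using pt[of z u] by (simp add: field_simps)
        then show "norm (fock_kernel \<alpha> z u * f u)
          \<le> norm ((c / exp (- (\<alpha> / 2) * (norm z)\<^sup>2)) * norm (gauss_kernel \<alpha> z u * g u))"
          by (simp only: real_norm_def abs_ge_self)
      qed
    qed measurable
    have bound: "norm (gauss_mult \<alpha> (integral_op (fock_kernel \<alpha>) f) z)
      \<le> c * norm (integral_op (gauss_kernel \<alpha>) g z)"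
      if i: "integrable lebesgue (\<lambda>u. gauss_kernel \<alpha> z u * g u)" for z
    proof -
      \<comment> \<open>The integrand of \<open>H\<close> at \<open>g\<close> is a nonnegative real,
        so the modulus of its integral is the integral of its modulus.\<close>
      have kg: "gauss_kernel \<alpha> z u * g u = complex_of_real (norm (gauss_kernel \<alpha> z u * g u))" for u
        by (simp add: gauss_kernel_def g_def norm_mult)
      have "norm (gauss_mult \<alpha> (integral_op (fock_kernel \<alpha>) f) z)
          = norm (integral_op (fock_kernel \<alpha>) f z) * exp (- (\<alpha> / 2) * (norm z)\<^sup>2)"
        by (simp add: gauss_mult_def norm_mult)
      also have "\<dots> \<le> (LINT u|lebesgue. norm (fock_kernel \<alpha> z u * f u)) * exp (- (\<alpha> / 2) * (norm z)\<^sup>2)"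
        unfolding integral_op_def by (intro mult_right_mono integral_norm_bound) auto
      also have "\<dots> = (LINT u|lebesgue. c * norm (gauss_kernel \<alpha> z u * g u))"
        unfolding pt[symmetric] by simp
      also have "\<dots> = c * (LINT u|lebesgue. norm (gauss_kernel \<alpha> z u * g u))"
        by simp
      also have "(LINT u|lebesgue. norm (gauss_kernel \<alpha> z u * g u))
          = norm (complex_of_real (LINT u|lebesgue. norm (gauss_kernel \<alpha> z u * g u)))"
        by (simp add: integral_nonneg_AE)
      also have "\<dots> = norm (integral_op (gauss_kernel \<alpha>) g z)"
        unfolding integral_op_def by (subst kg) (simp only: integral_complex_of_real)
      finally show ?thesis .
    qed
    have meas: "integral_op (fock_kernel \<alpha>) f \<in> borel_measurable lebesgue"
      by (simp add: measurable_integral_op measurable_fock_kernel)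
    have "(\<integral>\<^sup>+ z. ennreal (norm (gauss_mult \<alpha> (integral_op (fock_kernel \<alpha>) f) z) powr p)
      \<partial>weighted_measure w)
      \<le> (\<integral>\<^sup>+ z. ennreal (c powr p)
        * ennreal (norm (integral_op (gauss_kernel \<alpha>) g z) powr p) \<partial>weighted_measure w)"
    proof (rule nn_integral_mono_AE, unfold AE_weighted_measure[OF w], rule eventually_mono[OF intH])
      fix z assume "integrable lebesgue (\<lambda>u. gauss_kernel \<alpha> z u * g u)"
      then have "norm (gauss_mult \<alpha> (integral_op (fock_kernel \<alpha>) f) z) powr p
          \<le> (c * norm (integral_op (gauss_kernel \<alpha>) g z)) powr p"
        using p by (intro powr_mono2 bound) auto
      then show "ennreal (norm (gauss_mult \<alpha> (integral_op (fock_kernel \<alpha>) f) z) powr p)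
          \<le> ennreal (c powr p) * ennreal (norm (integral_op (gauss_kernel \<alpha>) g z) powr p)"
        using c by (simp add: powr_mult ennreal_mult[symmetric] ennreal_leI)
    qed
    also have "\<dots> = ennreal (c powr p)
      * (\<integral>\<^sup>+ z. ennreal (norm (integral_op (gauss_kernel \<alpha>) g z) powr p) \<partial>weighted_measure w)"
      using H2[OF g] by (intro nn_integral_cmult) (auto simp: Lp_space_def)
    finally have le: "(\<integral>\<^sup>+ z. ennreal (norm (gauss_mult \<alpha> (integral_op (fock_kernel \<alpha>) f) z) powr p)
      \<partial>weighted_measure w)
        \<le> \<dots>" .
    have "gauss_mult \<alpha> (integral_op (fock_kernel \<alpha>) f) \<in> borel_measurable (weighted_measure w)"
      by (simp add: measurable_weighted_measure measurable_gauss_mult meas)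
    note dom = Lp_space_dominated[OF _ conjunct1[OF H2[OF g]] this _ le]
    have "Fock_Lp_norm \<alpha> p w (integral_op (fock_kernel \<alpha>) f)
        \<le> (c powr p) powr (1 / p) * Lp_norm p (weighted_measure w) (integral_op (gauss_kernel \<alpha>) g)"
      unfolding Fock_Lp_norm_def using p by (intro dom) auto
    also have "\<dots> = c * Lp_norm p (weighted_measure w) (integral_op (gauss_kernel \<alpha>) g)"
      using p c by (simp add: powr_powr)
    also have "\<dots> \<le> c * (C * Lp_norm p (weighted_measure w) g)"
      using H2[OF g] c by (intro mult_left_mono) auto
    finally have "Fock_Lp_norm \<alpha> p w (integral_op (fock_kernel \<alpha>) f) \<le> c * C * Fock_Lp_norm \<alpha> p w f"
      by (simp add: gnorm)
    moreover have "integral_op (fock_kernel \<alpha>) f \<in> Fock_Lp_space \<alpha> p w"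
      unfolding Fock_Lp_space_def using p meas by (auto intro!: dom)
    moreover have "AE z in lebesgue. integrable lebesgue (\<lambda>u. fock_kernel \<alpha> z u * f u)"
      using intH by (rule eventually_mono) (rule int)
    ultimately show ?thesis by blast
  qed
  then show ?thesis
    unfolding P_bounded_def bounded_integral_op_def by blast
qed

section \<open>Testing the Fock projection on small cubes\<close>

lemma norm_hermitian_dot_le:
  fixes z :: "complex ^ 'n"
  assumes "u \<in> cube r z" "v \<in> cube r z"
  shows "norm (hermitian_dot (u - z) (v - z)) \<le> real CARD('n) * r\<^sup>2"
proof -
  have "norm (hermitian_dot (u - z) (v - z)) \<le> (\<Sum>j\<in>(UNIV :: 'n set). r * r)"
    unfolding hermitian_dot_def
  proof (rule sum_norm_le)
    fix j
    have "norm ((u - z) $ j) * norm ((v - z) $ j) \<le> r * r"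
      using norm_nth_diff_le_if_mem_cube[OF assms(1), of j] norm_nth_diff_le_if_mem_cube[OF assms(2), of j]
        order_trans[OF norm_ge_zero norm_nth_diff_le_if_mem_cube[OF assms(1), of j]]
      by (intro mult_mono) auto
    then show "norm ((u - z) $ j * cnj ((v - z) $ j)) \<le> r * r"
      by (simp only: norm_mult complex_mod_cnj)
  qed
  then show ?thesis by (simp add: power2_eq_square)
qed

lemma hermitian_dot_expand:
  "hermitian_dot z u = hermitian_dot z c + hermitian_dot c (u - c) + hermitian_dot (z - c) (u - c)"
  by (simp add: hermitian_dot_def sum.distrib[symmetric] algebra_simps)

text \<open>On the unit disc the modulus of exp is at least 1/e and its argument is at most 1, which
  is less than pi/2. The real part therefore has a positive lower bound.\<close>

lemma Re_exp_ge:
  assumes "norm \<zeta> \<le> 1"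
  shows "exp (- 1) * cos 1 \<le> Re (exp \<zeta>)"
proof -
  have "\<bar>Re \<zeta>\<bar> \<le> 1" "\<bar>Im \<zeta>\<bar> \<le> 1"
    using assms abs_Re_le_cmod[of \<zeta>] abs_Im_le_cmod[of \<zeta>] by auto
  then have "exp (- 1) \<le> exp (Re \<zeta>)" by simp
  moreover have "cos 1 \<le> cos \<bar>Im \<zeta>\<bar>"
    by (rule cos_monotone_0_pi_le) (use \<open>\<bar>Im \<zeta>\<bar> \<le> 1\<close> pi_gt3 in auto)
  moreover have "0 \<le> cos (1 :: real)"
    using pi_gt3 by (intro cos_ge_zero) auto
  ultimately have "exp (- 1) * cos 1 \<le> exp (Re \<zeta>) * cos \<bar>Im \<zeta>\<bar>"
    by (intro mult_mono) auto
  then show ?thesis by (simp add: Re_exp)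
qed

text \<open>Taking real parts shows that a phase inside the unit disc cannot cancel a nonnegative
  density. The bound on the exponent is asked only where h is nonzero, because the exponent used
  later is unbounded off the cube.\<close>

lemma norm_integral_exp_ge:
  fixes h :: "'a \<Rightarrow> real"
  assumes h: "integrable M h" "\<And>u. 0 \<le> h u" and \<zeta>: "\<zeta> \<in> borel_measurable M"
    and le: "\<And>u. h u \<noteq> 0 \<Longrightarrow> norm (\<zeta> u) \<le> 1"
  shows "exp (- 1) * cos 1 * (LINT u|M. h u) \<le> norm (LINT u|M. exp (\<zeta> u) * complex_of_real (h u))"
proof -
  note [measurable] = borel_measurable_integrable[OF h(1)] \<zeta>
  have int: "integrable M (\<lambda>u. exp (\<zeta> u) * complex_of_real (h u))"
  proof (rule Bochner_Integration.integrable_bound)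
    show "integrable M (\<lambda>u. exp 1 * h u)" using h by simp
    show "AE u in M. norm (exp (\<zeta> u) * complex_of_real (h u)) \<le> norm (exp 1 * h u)"
    proof (rule AE_I2)
      fix u
      show "norm (exp (\<zeta> u) * complex_of_real (h u)) \<le> norm (exp 1 * h u)"
      proof (cases "h u = 0")
        case False
        then have "Re (\<zeta> u) \<le> 1" using le[OF False] complex_Re_le_cmod[of "\<zeta> u"] by simp
        then show ?thesis by (simp add: norm_mult abs_mult mult_right_mono)
      qed simp
    qed
  qed measurable
  have "exp (- 1) * cos 1 * (LINT u|M. h u) = (LINT u|M. exp (- 1) * cos 1 * h u)"
    by simp
  also have "\<dots> \<le> (LINT u|M. Re (exp (\<zeta> u) * complex_of_real (h u)))"
  proof (rule integral_mono)
    fix u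
    show "exp (- 1) * cos 1 * h u \<le> Re (exp (\<zeta> u) * complex_of_real (h u))"
    proof (cases "h u = 0")
      case False
      then show ?thesis using Re_exp_ge[OF le[OF False]] h(2)[of u] by (simp add: mult_right_mono)
    qed simp
  qed (use h integrable_Re[OF int] in auto)
  also have "\<dots> = Re (LINT u|M. exp (\<zeta> u) * complex_of_real (h u))"
    by (rule integral_Re[OF int])
  also have "\<dots> \<le> norm (LINT u|M. exp (\<zeta> u) * complex_of_real (h u))"
    by (rule complex_Re_le_cmod)
  finally show ?thesis .
qed

text \<open>On the cube the Gaussian-weighted image of a suitable modulation of h has modulus at
  least a constant times the integral of h. Integrating its p-th power against w over the cube
  produces the left side, and the operator bound the right side.\<close>

lemma P_bounded_imp_local_testing:
  fixes w :: "complex ^ 'n \<Rightarrow> real"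
  assumes P: "P_bounded \<alpha> p w" and w: "weight w" and p: "1 < p" and \<alpha>: "0 < \<alpha>"
    and r: "\<alpha> * (real CARD('n) * r\<^sup>2) \<le> 1"
  shows "\<exists>C\<ge>0. \<forall>z0 h. integrable lebesgue h \<longrightarrow> (\<forall>u. 0 \<le> h u) \<longrightarrow> (\<forall>u. u \<notin> cube r z0 \<longrightarrow> h u = 0) \<longrightarrow>
    (\<integral>\<^sup>+ u. ennreal (h u powr p) \<partial>weighted_measure w) < \<infinity> \<longrightarrow>
    ennreal ((LINT u|lebesgue. h u) powr p) * emeasure (weighted_measure w) (cube r z0)
      \<le> ennreal C * (\<integral>\<^sup>+ u. ennreal (h u powr p) \<partial>weighted_measure w)"
proof -
  define \<mu> where "\<mu> = weighted_measure w"
  have meas\<mu>: "measurable \<mu> N = measurable lebesgue N" for N :: "'c measure"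
    by (simp add: \<mu>_def measurable_weighted_measure)
  obtain C where P2: "\<And>f. f \<in> Fock_Lp_space \<alpha> p w \<Longrightarrow>
      integral_op (fock_kernel \<alpha>) f \<in> Fock_Lp_space \<alpha> p w \<and>
      Fock_Lp_norm \<alpha> p w (integral_op (fock_kernel \<alpha>) f) \<le> C * Fock_Lp_norm \<alpha> p w f"
    using P unfolding P_bounded_def bounded_integral_op_def by blast
  \<comment> \<open>Boundedness supplies a constant of unknown sign; the p-th power below needs a
    nonnegative one.\<close>
  define B where "B = max 0 C"
  define \<kappa> where "\<kappa> = exp (- 1) * cos (1 :: real)"
  \<comment> \<open>The lower bound on the cube: normalisation of the Fock kernel, least value of
    the Gaussian there, and the loss from the remaining phase.\<close>
  define d where "d = (\<alpha> / pi) ^ CARD('n) * exp (- 1 / 2) * \<kappa>"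
  have "0 < cos (1 :: real)" using pi_gt3 by (intro cos_gt_zero) auto
  then have \<kappa>: "0 < \<kappa>" by (simp add: \<kappa>_def)
  then have d: "0 < d" using \<alpha> by (simp add: d_def)
  define K where "K = B powr p * exp (1 / 2) powr p / d powr p"
  have K: "0 \<le> K" by (simp add: K_def)
  have close: "norm (of_real \<alpha> * hermitian_dot (z - z0) (u - z0)) \<le> 1"
    "\<alpha> / 2 * (norm (z - z0))\<^sup>2 \<le> 1 / 2"
    if "z \<in> cube r z0" "u \<in> cube r z0" for z u z0 :: "complex ^ 'n"
  proof -
    have "\<alpha> * norm (hermitian_dot (z - z0) (u - z0)) \<le> 1" if "z \<in> cube r z0" "u \<in> cube r z0" for z u
      using norm_hermitian_dot_le[OF that] \<alpha> r by (intro order_trans[OF mult_left_mono r]) auto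
    note * = this
    show "norm (of_real \<alpha> * hermitian_dot (z - z0) (u - z0)) \<le> 1"
      using *[OF that] \<alpha> by (simp add: norm_mult)
    \<comment> \<open>The Gaussian bound is the phase bound on the diagonal, where the Hermitian
      product is the squared norm.\<close>
    have "(norm (z - z0))\<^sup>2 = Re (hermitian_dot (z - z0) (z - z0))"
      by (simp add: Re_hermitian_dot power2_norm_eq_inner)
    also have "\<dots> \<le> norm (hermitian_dot (z - z0) (z - z0))" by (rule complex_Re_le_cmod)
    finally have "\<alpha> * (norm (z - z0))\<^sup>2 \<le> \<alpha> * norm (hermitian_dot (z - z0) (z - z0))"
      using \<alpha> by (intro mult_left_mono) auto
    with *[OF that(1) that(1)] show "\<alpha> / 2 * (norm (z - z0))\<^sup>2 \<le> 1 / 2" by simp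
  qed
  have norm_diff: "(norm (z - u))\<^sup>2 = (norm z)\<^sup>2 + (norm u)\<^sup>2 - 2 * (z \<bullet> u)" for z u :: "complex ^ 'n"
    by (simp add: power2_norm_eq_inner inner_diff inner_commute)
  have main: "ennreal ((LINT u|lebesgue. h u) powr p) * emeasure \<mu> (cube r z0)
      \<le> ennreal K * (\<integral>\<^sup>+ u. ennreal (h u powr p) \<partial>\<mu>)"
    if hi: "integrable lebesgue h" and hn: "\<And>u. 0 \<le> h u" and hs: "\<And>u. u \<notin> cube r z0 \<Longrightarrow> h u = 0"
      and hp: "(\<integral>\<^sup>+ u. ennreal (h u powr p) \<partial>\<mu>) < \<infinity>" for h z0
  proof -
    have hm[measurable]: "h \<in> borel_measurable lebesgue" using hi by simp
    define m where "m = (LINT u|lebesgue. h u)"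
    have m: "0 \<le> m" unfolding m_def using hn by (intro integral_nonneg_AE) auto
    \<comment> \<open>The first term cancels the factor of the kernel that depends on u and z0
      alone, and the term with |u|^2 cancels its Gaussian. The constant in z0 is a normalisation:
      with it, \<open>gauss_mult\<close> of \<open>f\<close> has modulus exp(alpha/2 |u - z0|^2)
      h(u), comparable to h on the cube.\<close>
    define E where "E u = - (of_real \<alpha> * hermitian_dot z0 (u - z0))
        + of_real (\<alpha> * (norm u)\<^sup>2 - \<alpha> / 2 * (norm z0)\<^sup>2)" for u
    define f where "f u = exp (E u) * complex_of_real (h u)" for u
    have "E \<in> borel_measurable lebesgue"
      unfolding E_def hermitian_dot_def
      by (intro measurable_completion) (auto intro!: borel_measurable_continuous_onI continuous_intros)
    then have fm: "f \<in> borel_measurable lebesgue" unfolding f_def by measurable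
    have ReE: "Re (E u) - \<alpha> / 2 * (norm u)\<^sup>2 = \<alpha> / 2 * (norm (u - z0))\<^sup>2" for u
      unfolding E_def norm_diff
      by (simp add: Re_hermitian_dot inner_diff_right power2_norm_eq_inner inner_commute algebra_simps)
    have gf: "norm (gauss_mult \<alpha> f u) \<le> exp (1 / 2) * h u" for u
    proof (cases "u \<in> cube r z0")
      case True
      have "norm (gauss_mult \<alpha> f u) = exp (Re (E u)) * exp (- (\<alpha> / 2) * (norm u)\<^sup>2) * h u"
        using hn[of u] by (simp add: gauss_mult_def f_def norm_mult)
      also have "\<dots> = exp (Re (E u) - \<alpha> / 2 * (norm u)\<^sup>2) * h u"
        unfolding exp_add[symmetric] by simp
      also have "\<dots> \<le> exp (1 / 2) * h u"
        unfolding ReE using close(2)[OF True True] hn[of u] by (intro mult_right_mono) auto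
      finally show ?thesis .
    qed (simp add: gauss_mult_def f_def hs)
    have le1: "(\<integral>\<^sup>+ u. ennreal (norm (gauss_mult \<alpha> f u) powr p) \<partial>\<mu>)
        \<le> ennreal (exp (1 / 2) powr p) * (\<integral>\<^sup>+ u. ennreal (h u powr p) \<partial>\<mu>)"
    proof -
      have "(\<integral>\<^sup>+ u. ennreal (norm (gauss_mult \<alpha> f u) powr p) \<partial>\<mu>)
        \<le> (\<integral>\<^sup>+ u. ennreal (exp (1 / 2) powr p) * ennreal (h u powr p) \<partial>\<mu>)"
      proof (rule nn_integral_mono)
        fix u
        have "norm (gauss_mult \<alpha> f u) powr p \<le> (exp (1 / 2) * h u) powr p"
          using p gf by (intro powr_mono2) auto
        then show "ennreal (norm (gauss_mult \<alpha> f u) powr p)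
          \<le> ennreal (exp (1 / 2) powr p) * ennreal (h u powr p)"
          using hn[of u] by (simp only: powr_mult ennreal_mult[symmetric] powr_ge_zero exp_ge_zero ennreal_leI)
      qed
      also have "\<dots> = ennreal (exp (1 / 2) powr p) * (\<integral>\<^sup>+ u. ennreal (h u powr p) \<partial>\<mu>)"
        by (rule nn_integral_cmult) (simp add: meas\<mu>)
      finally show ?thesis .
    qed
    have gf_Lp: "gauss_mult \<alpha> f \<in> Lp_space p \<mu>"
      unfolding Lp_space_iff_nn_integral
      using le_less_trans[OF le1] hp measurable_gauss_mult[OF fm]
      by (auto simp: meas\<mu> ennreal_mult_less_top)
    then have fX: "f \<in> Fock_Lp_space \<alpha> p w"
      using fm by (simp add: Fock_Lp_space_def \<mu>_def)
    define g where "g = gauss_mult \<alpha> (integral_op (fock_kernel \<alpha>) f)"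
    have g_Lp: "g \<in> Lp_space p \<mu>" and g_norm: "Lp_norm p \<mu> g \<le> C * Lp_norm p \<mu> (gauss_mult \<alpha> f)"
      using P2[OF fX] by (auto simp: g_def Fock_Lp_space_def Fock_Lp_norm_def \<mu>_def)
    have "Lp_norm p \<mu> g \<le> B * Lp_norm p \<mu> (gauss_mult \<alpha> f)"
      by (rule order_trans[OF g_norm]) (simp add: B_def mult_right_mono Lp_norm_nonneg)
    then have "Lp_norm p \<mu> g powr p \<le> (B * Lp_norm p \<mu> (gauss_mult \<alpha> f)) powr p"
      using p by (intro powr_mono2) (auto simp: Lp_norm_nonneg)
    then have "(\<integral>\<^sup>+ z. ennreal (norm (g z) powr p) \<partial>\<mu>)
        \<le> ennreal (B powr p) * (\<integral>\<^sup>+ u. ennreal (norm (gauss_mult \<alpha> f u) powr p) \<partial>\<mu>)"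
      using p g_Lp gf_Lp
      by (simp add: nn_integral_eq_Lp_norm ennreal_mult[symmetric] powr_mult B_def Lp_norm_nonneg ennreal_leI)
    also have "\<dots> \<le> ennreal (B powr p) * (ennreal (exp (1 / 2) powr p)
      * (\<integral>\<^sup>+ u. ennreal (h u powr p) \<partial>\<mu>))"
      by (intro mult_left_mono le1) auto
    finally have upper: "(\<integral>\<^sup>+ z. ennreal (norm (g z) powr p) \<partial>\<mu>)
        \<le> ennreal (B powr p * exp (1 / 2) powr p) * (\<integral>\<^sup>+ u. ennreal (h u powr p) \<partial>\<mu>)"
      by (simp only: ennreal_mult_mult powr_ge_zero)
    have lower: "d * m \<le> norm (g z)" if z: "z \<in> cube r z0" for z
    proof -
      \<comment> \<open>The part of the integrand independent of u. Together with the Gaussian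
        weight at z its modulus is (alpha/pi)^n exp(-alpha/2 |z - z0|^2).\<close>
      define L where "L = of_real ((\<alpha> / pi) ^ CARD('n)) * exp (of_real \<alpha>
        * hermitian_dot z z0 - of_real (\<alpha> / 2 * (norm z0)\<^sup>2))"
      define \<zeta> where "\<zeta> u = of_real \<alpha> * hermitian_dot (z - z0) (u - z0)" for u
      have \<zeta>m: "\<zeta> \<in> borel_measurable lebesgue"
        unfolding \<zeta>_def hermitian_dot_def
        by (intro measurable_completion) (auto intro!: borel_measurable_continuous_onI continuous_intros)
      have "fock_kernel \<alpha> z u * f u = L * (exp (\<zeta> u) * complex_of_real (h u))" for u
      proof -
        have "fock_kernel \<alpha> z u * f u = of_real ((\<alpha> / pi) ^ CARD('n)) *
            (exp (of_real \<alpha> * hermitian_dot z u) * exp (of_real (- \<alpha>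
              * (norm u)\<^sup>2)) * exp (E u)) * complex_of_real (h u)"
          by (simp only: fock_kernel_def f_def exp_of_real mult_ac)
        also have "exp (of_real \<alpha> * hermitian_dot z u) * exp (of_real (- \<alpha> * (norm u)\<^sup>2)) * exp (E u)
            = exp (of_real \<alpha> * hermitian_dot z z0 - of_real (\<alpha> / 2 * (norm z0)\<^sup>2)) * exp (\<zeta> u)"
          unfolding exp_add[symmetric] E_def \<zeta>_def
          by (subst hermitian_dot_expand[of z u z0]) (simp add: algebra_simps)
        finally show ?thesis by (simp add: L_def mult_ac)
      qed
      then have "integral_op (fock_kernel \<alpha>) f z
        = L * (LINT u|lebesgue. exp (\<zeta> u) * complex_of_real (h u))"
        unfolding integral_op_def by simp
      then have "norm (g z) = norm L * exp (- (\<alpha> / 2)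
        * (norm z)\<^sup>2) * norm (LINT u|lebesgue. exp (\<zeta> u) * complex_of_real (h u))"
        by (simp add: g_def gauss_mult_def norm_mult)
      also have "norm L * exp (- (\<alpha> / 2) * (norm z)\<^sup>2)
        = (\<alpha> / pi) ^ CARD('n) * exp (- (\<alpha> / 2 * (norm (z - z0))\<^sup>2))"
      proof -
        have "norm L = (\<alpha> / pi) ^ CARD('n) * exp (\<alpha> * (z \<bullet> z0) - \<alpha> / 2 * (norm z0)\<^sup>2)"
          using \<alpha> by (simp add: L_def norm_mult norm_power norm_divide Re_hermitian_dot)
        then have "norm L * exp (- (\<alpha> / 2) * (norm z)\<^sup>2)
            = (\<alpha> / pi) ^ CARD('n) * exp (\<alpha> * (z \<bullet> z0) - \<alpha> / 2 * (norm z0)\<^sup>2 + - (\<alpha> / 2) * (norm z)\<^sup>2)"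
          by (simp only: exp_add mult.assoc)
        then show ?thesis unfolding norm_diff by (simp add: algebra_simps)
      qed
      finally have eq: "norm (g z) = (\<alpha> / pi) ^ CARD('n) * exp (- (\<alpha> / 2 * (norm (z - z0))\<^sup>2))
          * norm (LINT u|lebesgue. exp (\<zeta> u) * complex_of_real (h u))" .
      have "norm (\<zeta> u) \<le> 1" if "h u \<noteq> 0" for u
        unfolding \<zeta>_def using that hs by (intro close(1) z) auto
      then have "\<kappa> * m \<le> norm (LINT u|lebesgue. exp (\<zeta> u) * complex_of_real (h u))"
        unfolding \<kappa>_def m_def by (intro norm_integral_exp_ge hi hn \<zeta>m)
      moreover have "exp (- 1 / 2) \<le> exp (- (\<alpha> / 2 * (norm (z - z0))\<^sup>2))"
        using close(2)[OF z z] by simp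
      ultimately have "(\<alpha> / pi) ^ CARD('n) * exp (- 1 / 2) * (\<kappa> * m) \<le> norm (g z)"
        unfolding eq using \<alpha> \<kappa> m by (intro mult_mono) auto
      then show ?thesis by (simp add: d_def mult_ac)
    qed
    have "ennreal ((d * m) powr p) * emeasure \<mu> (cube r z0)
      = (\<integral>\<^sup>+ z. ennreal ((d * m) powr p) * indicator (cube r z0) z \<partial>\<mu>)"
      by (rule nn_integral_cmult_indicator[symmetric]) (simp add: \<mu>_def)
    also have "\<dots> \<le> (\<integral>\<^sup>+ z. ennreal (norm (g z) powr p) \<partial>\<mu>)"
      using lower d m p by (intro nn_integral_mono)
        (auto split: split_indicator intro!: ennreal_leI powr_mono2)
    also note upper
    finally have fin: "ennreal ((d * m) powr p) * emeasure \<mu> (cube r z0)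
        \<le> ennreal (B powr p * exp (1 / 2) powr p) * (\<integral>\<^sup>+ u. ennreal (h u powr p) \<partial>\<mu>)" .
    have "ennreal (m powr p) * emeasure \<mu> (cube r z0)
        = ennreal (1 / d powr p) * (ennreal ((d * m) powr p) * emeasure \<mu> (cube r z0))"
      using d m by (subst ennreal_mult_mult) (auto simp: powr_mult)
    also have "\<dots> \<le> ennreal (1 / d powr p) * (ennreal (B powr p * exp (1 / 2) powr p)
      * (\<integral>\<^sup>+ u. ennreal (h u powr p) \<partial>\<mu>))"
      by (intro mult_left_mono fin) auto
    also have "\<dots> = ennreal K * (\<integral>\<^sup>+ u. ennreal (h u powr p) \<partial>\<mu>)"
      by (subst ennreal_mult_mult) (auto simp: K_def)
    finally show ?thesis by (simp add: m_def)
  qed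
  show ?thesis
    using K main unfolding \<mu>_def by blast
qed

text \<open>Because w sigma^p = sigma, the test inequality for a truncation of sigma with integral m
  reads m^p W <= C m. Finiteness and positivity of m allow the division that gives m^(p-1) W <= C,
  and the truncation is then removed.\<close>

lemma P_bounded_imp_A_class:
  fixes w :: "complex ^ 'n \<Rightarrow> real"
  assumes P: "P_bounded \<alpha> p w" and w: "weight w" and p: "1 < p" and \<alpha>: "0 < \<alpha>"
    and r: "0 < r" "\<alpha> * (real CARD('n) * r\<^sup>2) \<le> 1"
  shows "w \<in> A_class p r"
proof -
  define \<sigma> where "\<sigma> = dual_weight p w"
  have \<sigma>: "weight \<sigma>" using w by (simp add: \<sigma>_def weight_dual_weight)
  note [measurable] = weight_measurable[OF w] weight_measurable[OF \<sigma>]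
  have \<sigma>n: "0 \<le> \<sigma> u" for u by (simp add: \<sigma>_def dual_weight_def)
  obtain C where C: "0 \<le> C" and test: "\<And>z0 h. integrable lebesgue h \<Longrightarrow> (\<forall>u. 0 \<le> h u) \<Longrightarrow>
    (\<forall>u. u \<notin> cube r z0 \<longrightarrow> h u = 0) \<Longrightarrow> (\<integral>\<^sup>+ u. ennreal (h u powr p) \<partial>weighted_measure w) < \<infinity> \<Longrightarrow>
    ennreal ((LINT u|lebesgue. h u) powr p) * emeasure (weighted_measure w) (cube r z0)
      \<le> ennreal C * (\<integral>\<^sup>+ u. ennreal (h u powr p) \<partial>weighted_measure w)"
    using P_bounded_imp_local_testing[OF P w p \<alpha> r(2)] by metis
  show ?thesis
  proof (rule A_classI[OF w p r(1), of C])
    fix z0 :: "complex ^ 'n"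
    define W where "W = emeasure (weighted_measure w) (cube r z0)"
    define V where "V = emeasure (weighted_measure \<sigma>) (cube r z0)"
    have W: "0 < W" and V: "0 < V"
      unfolding W_def V_def using w \<sigma> r by (auto intro: emeasure_weighted_cube_pos)
    \<comment> \<open>Truncation makes the test function bounded on a cube, hence integrable. Above
      level k the value is set to 0, not capped, so that w h^p = h stays an exact identity
      a.e.\<close>
    define h where "h k u = (if \<sigma> u \<le> real k then \<sigma> u else 0) * indicator (cube r z0) u" for k u
    have hm[measurable]: "h k \<in> borel_measurable lebesgue" for k
      unfolding h_def by measurable
    have hn: "0 \<le> h k u" for k u by (simp add: h_def \<sigma>n)
    have hi: "integrable lebesgue (h k)" for k
    proof (rule Bochner_Integration.integrable_bound)
      show "integrable lebesgue (\<lambda>u. real k * indicator (cube r z0) u)"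
        using lmeasurable_cube[of r z0] by (intro integrable_mult_right) (simp add: fmeasurable_def)
    qed (auto simp: h_def \<sigma>n split: split_indicator)
    define m where "m k = (LINT u|lebesgue. h k u)" for k
    have m: "0 \<le> m k" for k unfolding m_def using hn by (intro integral_nonneg_AE) auto
    have hnn: "(\<integral>\<^sup>+ u. ennreal (h k u) \<partial>lebesgue) = ennreal (m k)" for k
      unfolding m_def using hi hn by (intro nn_integral_eq_integral) auto
    have hp: "(\<integral>\<^sup>+ u. ennreal (h k u powr p) \<partial>weighted_measure w) = ennreal (m k)" for k
    proof -
      have "(\<integral>\<^sup>+ u. ennreal (h k u powr p) \<partial>weighted_measure w) = (\<integral>\<^sup>+ u. ennreal (h k u) \<partial>lebesgue)"
        unfolding nn_integral_weighted_measure[OF w, of "\<lambda>u. ennreal (h k u powr p)", simplified]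
      proof (rule nn_integral_cong_AE, rule eventually_mono[OF weight_pos[OF w]])
        fix u assume u: "0 < w u"
        \<comment> \<open>The exponent identity behind w sigma^p = sigma, since sigma is w to the
          power -1/(p-1).\<close>
        have "1 + - 1 / (p - 1) * p = - 1 / (p - 1)" using p by (simp add: field_simps)
        then have "w u * \<sigma> u powr p = \<sigma> u"
          using u unfolding \<sigma>_def dual_weight_def by (simp add: powr_powr powr_mult_base)
        then have "w u * h k u powr p = h k u" by (auto simp: h_def split: split_indicator)
        then show "ennreal (w u) * ennreal (h k u powr p) = ennreal (h k u)"
          using u by (simp add: ennreal_mult[symmetric])
      qed
      then show ?thesis by (simp add: hnn)
    qed
    have bound: "ennreal (m k powr (p - 1)) * W \<le> ennreal C" for k
    proof (cases "m k = 0")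
      case False
      then have mk: "0 < m k" using m[of k] by simp
      have "ennreal (m k powr p) * W \<le> ennreal C * ennreal (m k)"
        using test[of "h k" z0] hi hn hp[of k] unfolding W_def m_def[symmetric] by (auto simp: h_def)
      then have "ennreal (1 / m k) * (ennreal (m k powr p) * W)
        \<le> ennreal (1 / m k) * (ennreal C * ennreal (m k))"
        by (rule mult_left_mono) simp
      also have "\<dots> = ennreal C"
        using mk C by (simp add: ennreal_mult[symmetric])
      finally show ?thesis
        using mk by (simp add: ennreal_mult_mult powr_diff)
    qed simp
    have V_SUP: "V = (SUP k. ennreal (m k))"
    proof -
      have "V = (\<integral>\<^sup>+ u. (SUP k. ennreal (h k u)) \<partial>lebesgue)"
        unfolding V_def emeasure_weighted_measure[OF \<sigma> sets_cube(1)]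
      proof (rule nn_integral_cong)
        fix u
        obtain k0 where k0: "\<sigma> u \<le> real k0" using real_arch_simple by blast
        have "(SUP k. ennreal (h k u)) = ennreal (\<sigma> u * indicator (cube r z0) u)"
        proof (rule antisym)
          show "(SUP k. ennreal (h k u)) \<le> ennreal (\<sigma> u * indicator (cube r z0) u)"
            by (intro SUP_least ennreal_leI) (auto simp: h_def \<sigma>n split: split_indicator)
          show "ennreal (\<sigma> u * indicator (cube r z0) u) \<le> (SUP k. ennreal (h k u))"
            by (rule SUP_upper2[of k0]) (use k0 in \<open>auto simp: h_def\<close>)
        qed
        then show "ennreal (\<sigma> u) * indicator (cube r z0) u = (SUP k. ennreal (h k u))"
          by (auto split: split_indicator)
      qed
      also have "\<dots> = (SUP k. (\<integral>\<^sup>+ u. ennreal (h k u) \<partial>lebesgue))"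
      proof (rule nn_integral_monotone_convergence_SUP)
        show "incseq (\<lambda>k u. ennreal (h k u))"
          by (auto simp: incseq_def le_fun_def h_def \<sigma>n intro!: ennreal_leI split: split_indicator)
      qed measurable
      finally show ?thesis by (simp add: hnn)
    qed
    \<comment> \<open>\<open>V\<close> is positive, so some truncation has positive mass; its bound
      shows that \<open>W\<close> is finite. Only then can the bound be divided by \<open>W\<close>
      to control all truncations, and with them \<open>V\<close>.\<close>
    obtain k1 where "0 < m k1"
      using V unfolding V_SUP by (auto simp: less_SUP_iff)
    then have "W \<noteq> top"
      using bound[of k1] by (auto simp: ennreal_mult_top top_unique)
    then obtain W' where W': "W = ennreal W'" "0 < W'"
      using W by (cases W) auto
    have "m k \<le> (C / W') powr (1 / (p - 1))" for k
    proof -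
      have "m k powr (p - 1) * W' \<le> C"
        using bound[of k] W' C by (simp add: ennreal_mult[symmetric] ennreal_le_iff)
      then have "m k powr (p - 1) \<le> C / W'" using W' by (simp add: field_simps)
      then have "(m k powr (p - 1)) powr (1 / (p - 1)) \<le> (C / W') powr (1 / (p - 1))"
        using p by (intro powr_mono2) auto
      then show ?thesis using p m[of k] by (simp add: powr_powr)
    qed
    then have "V \<le> ennreal ((C / W') powr (1 / (p - 1)))"
      unfolding V_SUP by (intro SUP_least ennreal_leI)
    then have "W * ennreal_powr V (p - 1)
      \<le> W * ennreal_powr (ennreal ((C / W') powr (1 / (p - 1)))) (p - 1)"
      using p by (intro mult_left_mono ennreal_powr_mono) auto
    also have "\<dots> = ennreal C"
      using p W' C by (simp add: ennreal_powr_ennreal powr_powr ennreal_mult[symmetric])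
    finally show "emeasure (weighted_measure w) (cube r z0) *
        ennreal_powr (emeasure (weighted_measure (dual_weight p w)) (cube r z0)) (p - 1) \<le> ennreal C"
      by (simp add: W_def V_def \<sigma>_def)
  qed
qed

theorem theorem3p1:
  fixes w :: "complex ^ 'n \<Rightarrow> real" and p \<alpha> :: real
  assumes "1 < p" and "0 < \<alpha>" and "weight w"
  shows "((\<exists>r>0. w \<in> A_class p r) \<longleftrightarrow> H_bounded \<alpha> p w) \<and>
         (H_bounded \<alpha> p w \<longleftrightarrow> P_bounded \<alpha> p w) \<and>
         (P_bounded \<alpha> p w \<longleftrightarrow> (\<forall>r>0. w \<in> A_class p r))"
proof -
  \<comment> \<open>The largest side allowed by the testing argument: alpha n epsilon^2 equals
    1.\<close>
  define \<epsilon> where "\<epsilon> = 1 / sqrt (\<alpha> * real CARD('n))"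
  have \<epsilon>: "0 < \<epsilon>" "\<alpha> * (real CARD('n) * \<epsilon>\<^sup>2) \<le> 1"
    using assms(2) by (auto simp: \<epsilon>_def power_divide)
  have "H_bounded \<alpha> p w" if "w \<in> A_class p r" "0 < r" for r
    using A_class_imp_H_bounded that assms by blast
  moreover have "P_bounded \<alpha> p w" if "H_bounded \<alpha> p w"
    using H_bounded_imp_P_bounded that assms by blast
  moreover have "w \<in> A_class p r" if "P_bounded \<alpha> p w" "0 < r" for r
    using A_class_change_scale[OF P_bounded_imp_A_class] that \<epsilon> assms by blast
  \<comment> \<open>The implications form a cycle (a), (b), (c), (d); it closes because membership
    for all sides includes the side 1.\<close>
  ultimately show ?thesis using zero_less_one by blast
qed

end
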